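(* On valid boundary-connected diagrams, the right exchange relation $\to_R$ is confluent. Consequently every valid boundary-connected diagram $D$ reduces by right exchanges to a unique right normal form, obtained by applying admissible right exchanges in any order until none applies, and two valid boundary-connected diagrams are equivalent if and only if they have the same right normal form.
   Context: A diagram is a tuple $D=(S,N,H,I,O)$ with $S,N\in\mathbb N$ and $H,I,O:\{0,\dots,N-1\}\to\mathbb N$; $\Delta(n)=O(n)-I(n)$, $W(0)=S$, $W(n+1)=W(n)+\Delta(n)$; $D$ is valid if $W(n)\ge H(n)+I(n)$ for all $n<N$. Geometrically, the vertex at height $n$ (heights numbered top to bottom) has as inputs the wires $H(n),\dots,H(n)+I(n)-1$ among the $W(n)$ wires crossing level $n$ (numbered left to right) and as outputs the wires $H(n),\dots,H(n)+O(n)-1$ of level $n+1$; wire $k<H(n)$ of level $n$ continues as wire $k$ of level $n+1$ and wire $k\ge H(n)+I(n)$ continues as wire $k+\Delta(n)$. Edges are the resulting maximal wire chains; the underlying graph has the vertices of $D$ as vertices and the edges joining two vertices as edges. $D$ is boundary-connected if the underlying graph is connected, or every vertex is joined by a path in it to a vertex incident to an edge reaching the top (level $0$) or bottom (level $N$) boundary. For $0\le n\le N-2$: a right exchange at height $n$ is admissible when $H(n+1)\ge H(n)+O(n)$ and yields the diagram identical to $D$ except $H'(n)=H(n+1)-\Delta(n)$, $I'(n)=I(n+1)$, $O'(n)=O(n+1)$, $H'(n+1)=H(n)$, $I'(n+1)=I(n)$, $O'(n+1)=O(n)$ (written $D\to_R D'$); a left exchange at height $n$ is admissible when $H(n)\ge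 H(n+1)+I(n+1)$ and yields the diagram identical except $H'(n)=H(n+1)$, $I'(n)=I(n+1)$, $O'(n)=O(n+1)$, $H'(n+1)=H(n)+\Delta(n+1)$, $I'(n+1)=I(n)$, $O'(n+1)=O(n)$. Two diagrams are equivalent if they are related by a finite sequence of right and left exchanges. A right normal form is a valid diagram admitting no right exchange; the right normal form of $D$ is a right normal form reachable from $D$ by right exchanges. *)

theory Defs
  imports
    "Graph_Theory.Digraph_Component"
    "HOL-Library.Confluence"
begin

text \<open>
  The functions $H, I, O : \{0,\dots,N-1\} \to \mathbb{N}$ are stored together as a list of length
  $N$, so that two diagrams are equal exactly when $S$, $N$ and the values of $H$, $I$, $O$ below
  $N$ agree.  The values of \<open>H_of\<close>, \<open>I_of\<close>, \<open>O_of\<close> at arguments $n \ge N$ are irrelevant: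
  every use below is guarded by $n < N$ (for \<open>W\<close>, by $n \le N$).
\<close>

datatype vertex = Vertex (offset: nat) (inputs: nat) (outputs: nat)

datatype diagram = Diagram (source: nat) (vertices: "vertex list")

definition num_vertices :: "diagram \<Rightarrow> nat" where
  "num_vertices D = length (vertices D)"

definition H_of :: "diagram \<Rightarrow> nat \<Rightarrow> nat" where
  "H_of D n = offset (vertices D ! n)"

definition I_of :: "diagram \<Rightarrow> nat \<Rightarrow> nat" where
  "I_of D n = inputs (vertices D ! n)"

definition O_of :: "diagram \<Rightarrow> nat \<Rightarrow> nat" where
  "O_of D n = outputs (vertices D ! n)"

definition Delta :: "diagram \<Rightarrow> nat \<Rightarrow> int" where
  "Delta D n = int (O_of D n) - int (I_of D n)"

fun W :: "diagram \<Rightarrow> nat \<Rightarrow> int" where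
  "W D 0 = int (source D)"
| "W D (Suc n) = W D n + Delta D n"

definition valid :: "diagram \<Rightarrow> bool" where
  "valid D \<longleftrightarrow> (\<forall>n < num_vertices D. W D n \<ge> int (H_of D n) + int (I_of D n))"

text \<open>
  The pair \<open>(n, k)\<close> stands for wire \<open>k\<close> crossing level \<open>n\<close>.
\<close>

definition wires :: "diagram \<Rightarrow> (nat \<times> nat) set" where
  "wires D = {(n, k). n \<le> num_vertices D \<and> int k < W D n}"

definition continues :: "diagram \<Rightarrow> nat \<times> nat \<Rightarrow> nat \<times> nat \<Rightarrow> bool" where
  "continues D p q \<longleftrightarrow> p \<in> wires D \<and> q \<in> wires D \<and>
     (\<exists>n k j. p = (n, k) \<and> q = (Suc n, j) \<and>
        (k < H_of D n \<and> j = k \<or>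
         k \<ge> H_of D n + I_of D n \<and> int j = int k + Delta D n))"

definition input_wires :: "diagram \<Rightarrow> nat \<Rightarrow> (nat \<times> nat) set" where
  "input_wires D n = {(n, k) | k. H_of D n \<le> k \<and> k < H_of D n + I_of D n}"

definition output_wires :: "diagram \<Rightarrow> nat \<Rightarrow> (nat \<times> nat) set" where
  "output_wires D n = {(Suc n, k) | k. H_of D n \<le> k \<and> k < H_of D n + O_of D n}"

definition edges :: "diagram \<Rightarrow> (nat \<times> nat) set set" where
  "edges D = {e. e \<noteq> {} \<and> pred_on.maxchain (wires D) ((continues D)\<^sup>+\<^sup>+) e}"

text \<open>
  An arc \<open>(u, e, v)\<close> of the underlying graph is an edge \<open>e\<close> starting at an output of \<open>u\<close> and ending
  at an input of \<open>v\<close>, so parallel edges are kept apart.  The downward orientation serves only to fit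
  the graph into a digraph; connectedness and paths below refer to the symmetric closure.
\<close>

definition underlying_graph :: "diagram \<Rightarrow> (nat, nat \<times> (nat \<times> nat) set \<times> nat) pre_digraph" where
  "underlying_graph D =
     \<lparr> verts = {..<num_vertices D},
       arcs = {(u, e, v). u < num_vertices D \<and> v < num_vertices D \<and> e \<in> edges D \<and>
                 e \<inter> output_wires D u \<noteq> {} \<and> e \<inter> input_wires D v \<noteq> {}},
       tail = (\<lambda>(u, e, v). u),
       head = (\<lambda>(u, e, v). v) \<rparr>"

definition joined_by_path :: "diagram \<Rightarrow> nat \<Rightarrow> nat \<Rightarrow> bool" where
  "joined_by_path D u v \<longleftrightarrow> reachable (with_proj (mk_symmetric (underlying_graph D))) u v"

definition reaches_boundary :: "diagram \<Rightarrow> (nat \<times> nat) set \<Rightarrow> bool" where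
  "reaches_boundary D e \<longleftrightarrow> (\<exists>k. (0, k) \<in> e) \<or> (\<exists>k. (num_vertices D, k) \<in> e)"

definition boundary_vertex :: "diagram \<Rightarrow> nat \<Rightarrow> bool" where
  "boundary_vertex D v \<longleftrightarrow> v < num_vertices D \<and>
     (\<exists>e \<in> edges D. reaches_boundary D e \<and> e \<inter> (input_wires D v \<union> output_wires D v) \<noteq> {})"

definition boundary_connected :: "diagram \<Rightarrow> bool" where
  "boundary_connected D \<longleftrightarrow>
     connected (underlying_graph D) \<or>
     (\<forall>u < num_vertices D. \<exists>v. boundary_vertex D v \<and> joined_by_path D u v)"

text \<open>
  In both exchanges the admissibility condition makes the argument of \<open>nat\<close> nonnegative, so no
  truncation takes place.
\<close>

definition right_admissible :: "diagram \<Rightarrow> nat \<Rightarrow> bool" where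
  "right_admissible D n \<longleftrightarrow> Suc n < num_vertices D \<and> H_of D (Suc n) \<ge> H_of D n + O_of D n"

definition right_exchange_at :: "diagram \<Rightarrow> nat \<Rightarrow> diagram" where
  "right_exchange_at D n = Diagram (source D)
     ((vertices D)
       [n := Vertex (nat (int (H_of D (Suc n)) - Delta D n)) (I_of D (Suc n)) (O_of D (Suc n)),
        Suc n := Vertex (H_of D n) (I_of D n) (O_of D n)])"

definition left_admissible :: "diagram \<Rightarrow> nat \<Rightarrow> bool" where
  "left_admissible D n \<longleftrightarrow> Suc n < num_vertices D \<and> H_of D n \<ge> H_of D (Suc n) + I_of D (Suc n)"

definition left_exchange_at :: "diagram \<Rightarrow> nat \<Rightarrow> diagram" where
  "left_exchange_at D n = Diagram (source D)
     ((vertices D)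
       [n := Vertex (H_of D (Suc n)) (I_of D (Suc n)) (O_of D (Suc n)),
        Suc n := Vertex (nat (int (H_of D n) + Delta D (Suc n))) (I_of D n) (O_of D n)])"

definition right_exchange :: "diagram \<Rightarrow> diagram \<Rightarrow> bool" where
  "right_exchange D D' \<longleftrightarrow> (\<exists>n. right_admissible D n \<and> D' = right_exchange_at D n)"

definition left_exchange :: "diagram \<Rightarrow> diagram \<Rightarrow> bool" where
  "left_exchange D D' \<longleftrightarrow> (\<exists>n. left_admissible D n \<and> D' = left_exchange_at D n)"

definition equivalent :: "diagram \<Rightarrow> diagram \<Rightarrow> bool" where
  "equivalent = (\<lambda>D D'. right_exchange D D' \<or> left_exchange D D')\<^sup>*\<^sup>*"

definition right_normal_form :: "diagram \<Rightarrow> bool" where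
  "right_normal_form D \<longleftrightarrow> valid D \<and> \<not> (\<exists>D'. right_exchange D D')"

definition right_normal_form_of :: "diagram \<Rightarrow> diagram \<Rightarrow> bool" where
  "right_normal_form_of D E \<longleftrightarrow> right_exchange\<^sup>*\<^sup>* D E \<and> right_normal_form E"

text \<open>
  Meaningful only for diagrams with exactly one reachable right normal form.
\<close>

definition the_right_normal_form :: "diagram \<Rightarrow> diagram" where
  "the_right_normal_form D = (THE E. right_normal_form_of D E)"

end

theory Submission
  imports Defs
begin

text \<open>
  Critical pairs of right exchanges always close, so by Newman's lemma only termination matters, and
  only there connectivity enters.  Label every wire by the port at which its edge starts.  A right
  exchange of \<open>x\<close> and \<open>y\<close> changes neither the labelled graph nor the wires seen by the other
  vertices, and each exchange turns \<open>y\<close> a further half turn counterclockwise around \<open>x\<close>.  If \<open>e\<close> is an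
  edge from \<open>s\<close> to \<open>t\<close> with \<open>v\<close> at neither end, the half turns of \<open>v\<close> around \<open>t\<close> and those around
  \<open>s\<close> differ by the change of the position of \<open>v\<close> relative to \<open>e\<close> (right \<open>1\<close>, left \<open>-1\<close>, not at the
  height of \<open>e\<close>: \<open>0\<close>).  Adjacent vertices are never exchanged and nothing turns around the
  boundary.  Hence along a path from \<open>u\<close> to \<open>v\<close> or to the boundary the number of exchanges of \<open>u\<close> with
  \<open>v\<close> telescopes to a bounded function of the current diagram, so every reduction is finite.
\<close>

section \<open>Labelled diagrams\<close>

text \<open>
  The port \<open>(Some x, j)\<close> is the \<open>j\<close>-th output of vertex \<open>x\<close>, and \<open>(None, k)\<close> is the \<open>k\<close>-th wire at the
  top.  A labelled diagram is run from top to bottom on the list of ports at which the current wires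
  start.
\<close>

type_synonym 'a port = "'a option \<times> nat"

fun fire :: "'a \<times> vertex \<Rightarrow> 'a port list \<Rightarrow> 'a port list" where
  "fire (x, v) ws = take (offset v) ws @ map (Pair (Some x)) [0..<outputs v] @
     drop (offset v + inputs v) ws"

text \<open>
  For each vertex, the ports of the wires to its left, entering it, and to its right.
\<close>

fun trace :: "'a port list \<Rightarrow> ('a \<times> vertex) list
    \<Rightarrow> ('a \<times> 'a port set \<times> 'a port set \<times> 'a port set) set" where
  "trace ws [] = {}"
| "trace ws (p # ps) = insert
     (fst p, set (take (offset (snd p)) ws), set (take (inputs (snd p)) (drop (offset (snd p)) ws)),
      set (drop (offset (snd p) + inputs (snd p)) ws)) (trace (fire p ws) ps)"

lemma trace_append: "trace ws (ps @ qs) = trace ws ps \<union> trace (fold fire ps ws) qs"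
  by (induction ps arbitrary: ws) auto

lemma fst_trace: "fst ` trace ws ps = fst ` set ps"
  by (induction ps arbitrary: ws) auto

text \<open>The lower end \<open>None\<close> stands for the bottom boundary.\<close>

definition ends :: "'a port list \<Rightarrow> ('a \<times> vertex) list \<Rightarrow> ('a port \<times> 'a option) set" where
  "ends ws ps = (\<Union>(x, l, m, r) \<in> trace ws ps. (\<lambda>e. (e, Some x)) ` m) \<union>
     (\<lambda>e. (e, None)) ` set (fold fire ps ws)"

lemma ends_Nil: "ends ws [] = (\<lambda>e. (e, None)) ` set ws"
  by (simp add: ends_def)

lemma ends_Cons: "ends ws (p # ps) = (\<lambda>e. (e, Some (fst p))) `
    set (take (inputs (snd p)) (drop (offset (snd p)) ws)) \<union> ends (fire p ws) ps"
  by (simp add: ends_def Un_assoc)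

section \<open>Widths, fresh ports and uniqueness of edge ends\<close>

text \<open>List form of validity, see \<open>valid_iff_fits\<close>. The guard makes the truncated
  subtraction in the recursive call exact.\<close>

fun fits :: "nat \<Rightarrow> vertex list \<Rightarrow> bool" where
  "fits w [] \<longleftrightarrow> True"
| "fits w (v # vs) \<longleftrightarrow> offset v + inputs v \<le> w \<and> fits (w - inputs v + outputs v) vs"

lemma length_fire: "offset v + inputs v \<le> length ws \<Longrightarrow>
    length (fire (x, v) ws) = length ws - inputs v + outputs v"
  by simp

lemma fits_append: "fits (length ws) (map snd (ps @ qs)) \<longleftrightarrow>
    fits (length ws) (map snd ps) \<and> fits (length (fold fire ps ws)) (map snd qs)"
proof (induction ps arbitrary: ws)
  case (Cons p ps)
  obtain x v where p: "p = (x, v)" by fastforce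
  show ?case
  proof (cases "offset v + inputs v \<le> length ws")
    case True
    then show ?thesis using Cons[of "fire p ws"] length_fire[OF True, of x]
      by (simp add: p del: fire.simps)
  next
    case False
    then show ?thesis by (simp add: p)
  qed
qed simp

text \<open>\<open>X\<close> is meant for vertices still to fire: no current wire starts at one of
  them, so their outputs will be new ports.\<close>

definition fresh :: "'a set \<Rightarrow> 'a port list \<Rightarrow> bool" where
  "fresh X ws \<longleftrightarrow> distinct ws \<and> fst ` set ws \<inter> Some ` X = {}"

text \<open>The new ports carry the label \<open>x\<close>, which no wire of \<open>ws\<close>
  carries; the wires kept on the two sides come from disjoint parts of \<open>ws\<close>.\<close>

lemma fresh_fire:
  assumes "fresh (insert x X) ws" and "x \<notin> X"
  shows "fresh X (fire (x, v) ws)"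
proof -
  let ?A = "take (offset v) ws" and ?B = "drop (offset v + inputs v) ws"
  let ?O = "map (Pair (Some x)) [0..<outputs v]"
  have d: "distinct ws" and X: "fst ` set ws \<inter> Some ` X = {}" and x: "Some x \<notin> fst ` set ws"
    using assms(1) by (auto simp: fresh_def)
  have sub: "set ?A \<subseteq> set ws" "set ?B \<subseteq> set ws"
    by (simp_all add: set_take_subset set_drop_subset)
  have O: "fst ` set ?O \<subseteq> {Some x}" by auto
  have AB: "set ?A \<inter> set ?B = {}"
    by (intro set_take_disj_set_drop_if_distinct d) simp
  have "set ws \<inter> set ?O = {}" using x by (auto simp: image_iff)
  then have "set ?A \<inter> (set ?O \<union> set ?B) = {}" "set ?O \<inter> set ?B = {}"
    using sub AB by (auto simp only: disjoint_iff subset_iff Un_iff)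
  moreover have "distinct ?O" by (simp add: distinct_map inj_on_def)
  ultimately have "distinct (fire (x, v) ws)"
    using d by (simp add: Int_Un_distrib del: set_map)
  moreover have "fst ` set (fire (x, v) ws) \<subseteq> fst ` set ws \<union> {Some x}"
    using image_mono[OF sub(1), of fst] image_mono[OF sub(2), of fst] O
    by (auto simp only: fire.simps set_append image_Un)
  moreover have "Some x \<notin> Some ` X" using assms(2) by auto
  moreover have "Q \<inter> R = {}" if "Q \<subseteq> P \<union> {c}" "c \<notin> R" "P \<inter> R = {}" for P Q R :: "'a option set" and c
    using that by blast
  ultimately have "distinct (fire (x, v) ws)" "fst ` set (fire (x, v) ws) \<inter> Some ` X = {}"
    using X by metis+
  then show ?thesis by (simp add: fresh_def)
qed

lemma fresh_fold:
  assumes "fresh (X \<union> fst ` set ps) ws" and "distinct (map fst ps)" and "X \<inter> fst ` set ps = {}"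
  shows "fresh X (fold fire ps ws)"
  using assms
proof (induction ps arbitrary: ws)
  case (Cons p ps)
  obtain x v where p: "p = (x, v)" by fastforce
  have "fresh (X \<union> fst ` set ps) (fire p ws)"
    using Cons.prems unfolding p by (intro fresh_fire) (auto simp: insert_commute)
  then show ?case using Cons by auto
qed (auto simp: fresh_def)

lemma ends_source:
  assumes "(e, t) \<in> ends ws ps"
  shows "e \<in> set ws \<or> (\<exists>(x, v) \<in> set ps. \<exists>j < outputs v. e = (Some x, j))"
  using assms
proof (induction ps arbitrary: ws)
  case (Cons p ps)
  obtain x v where p: "p = (x, v)" by fastforce
  from Cons.prems consider "e \<in> set ws" | "(e, t) \<in> ends (fire p ws) ps"
    unfolding ends_Cons by (auto dest: in_set_takeD in_set_dropD)
  then show ?case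
  proof cases
    case 2
    from Cons.IH[OF this] show ?thesis by (auto simp: p dest: in_set_takeD in_set_dropD)
  qed simp
qed (auto simp: ends_Nil)

lemma ends_target: "(e, Some x) \<in> ends ws ps \<Longrightarrow> x \<in> fst ` set ps"
  unfolding ends_def fst_trace[symmetric, of _ ws] by force

lemma take_take_drop: "take h ws @ take i (drop h ws) @ drop (h + i) ws = ws"
  by (metis append_take_drop_id drop_drop add.commute)

text \<open>A consumed port leaves the wire list, and freshness prevents any later vertex from
  creating it again.\<close>

lemma ends_unique:
  assumes "fresh (fst ` set ps) ws" and "distinct (map fst ps)"
    and "(e, t) \<in> ends ws ps" and "(e, t') \<in> ends ws ps"
  shows "t = t'"
  using assms
proof (induction ps arbitrary: ws)
  case (Cons p ps)
  obtain x v where p: "p = (x, v)" by fastforce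
  let ?m = "set (take (inputs v) (drop (offset v) ws))"
  have fr: "fresh (fst ` set ps) (fire p ws)"
    using Cons.prems unfolding p by (intro fresh_fire) auto
  have "(e, s) \<notin> ends (fire p ws) ps" if e: "e \<in> ?m" for s
  proof
    assume "(e, s) \<in> ends (fire p ws) ps"
    from ends_source[OF this] have *: "e \<in> set (fire p ws) \<or> (\<exists>y\<in>fst ` set ps. fst e = Some y)"
      by force
    have "e \<in> set ws" using e by (auto dest: in_set_takeD in_set_dropD)
    then have nf: "fst e \<notin> Some ` fst ` set (p # ps)"
      using Cons.prems(1) unfolding fresh_def by blast
    have "distinct (take (offset v) ws @ take (inputs v) (drop (offset v) ws) @
        drop (offset v + inputs v) ws)"
      using Cons.prems(1) by (simp add: fresh_def take_take_drop)
    then have "e \<notin> set (take (offset v) ws)" "e \<notin> set (drop (offset v + inputs v) ws)"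
      using e by (simp_all only: distinct_append set_append disjoint_iff Un_iff) metis+
    moreover have "e \<notin> set (map (Pair (Some x)) [0..<outputs v])"
      using nf by (cases e) (auto simp: p)
    ultimately have "e \<notin> set (fire p ws)" by (simp add: p)
    moreover have "\<not> (\<exists>y\<in>fst ` set ps. fst e = Some y)" using nf by auto
    ultimately show False using * by blast
  qed
  then show ?case using Cons.IH[OF fr] Cons.prems(2-) unfolding ends_Cons p
    by auto
qed (auto simp: ends_Nil)

section \<open>Exchanging two consecutive vertices\<close>

text \<open>The vertex \<open>b\<close> lifted above \<open>a\<close>, with offset H(n+1) -
  \<Delta>(n). The truncated subtraction is exact once
  \<open>offset a + outputs a \<le> offset b\<close>.\<close>

definition swap_up :: "vertex \<Rightarrow> vertex \<Rightarrow> vertex" where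
  "swap_up a b = Vertex (offset b - outputs a + inputs a) (inputs b) (outputs b)"

text \<open>The right exchange on labelled lists: \<open>x\<close> lies above \<open>y\<close>
  before it and below \<open>y\<close> after it. Labels travel with their vertices, so a vertex can
  be followed through a whole reduction.\<close>

definition passes :: "'a \<Rightarrow> 'a \<Rightarrow> ('a \<times> vertex) list \<Rightarrow> ('a \<times> vertex) list \<Rightarrow> bool" where
  "passes x y ps ps' \<longleftrightarrow> (\<exists>us a b vs. offset a + outputs a \<le> offset b \<and>
     ps = us @ (x, a) # (y, b) # vs \<and> ps' = us @ (y, swap_up a b) # (x, a) # vs)"

text \<open>The two vertices act on disjoint windows, and the width below both does not depend on
  their order.\<close>

lemma fits_exchange:
  assumes "offset a + outputs a \<le> offset b"
  shows "fits w (us @ a # b # vs) \<longleftrightarrow> fits w (us @ swap_up a b # a # vs)"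
proof (induction us arbitrary: w)
  case Nil
  have "w - inputs a + outputs a - inputs b + outputs b =
      w - inputs b + outputs b - inputs a + outputs a"
    if "inputs a + inputs b \<le> w" using that by simp
  then show ?case using assms by (auto simp: swap_up_def)
qed simp

lemma split_window:
  assumes "h + i \<le> length ws"
  obtains A B C where "ws = A @ B @ C" "length A = h" "length B = i"
proof
  show "ws = take h ws @ take i (drop h ws) @ drop (h + i) ws"
    by (simp add: take_take_drop)
qed (use assms in auto)

text \<open>The wires above the pair split from left to right into \<open>A\<close>, the inputs
  \<open>I\<close> of \<open>a\<close>, the wires \<open>M\<close> in between, the inputs
  \<open>J\<close> of \<open>b\<close>, and \<open>B\<close>. Both orders yield the same wires
  below; only what each vertex sees of the other changes.\<close>

lemma exchange_window:
  assumes le: "offset a + outputs a \<le> offset b"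
    and fits: "fits (length ws) (a # b # vs)"
  obtains A I M J B where
    "set ws = set A \<union> set I \<union> set M \<union> set J \<union> set B" "distinct ws = distinct (A @ I @ M @ J @ B)"
    "trace ws [(x, a), (y, b)] =
       {(x, set A, set I, set (M @ J @ B)),
        (y, set (A @ map (Pair (Some x)) [0..<outputs a] @ M), set J, set B)}"
    "trace ws [(y, swap_up a b), (x, a)] =
       {(x, set A, set I, set (M @ map (Pair (Some y)) [0..<outputs b] @ B)),
        (y, set (A @ I @ M), set J, set B)}"
    "fold fire [(x, a), (y, b)] ws = A @ map (Pair (Some x)) [0..<outputs a] @ M @
        map (Pair (Some y)) [0..<outputs b] @ B"
    "fold fire [(y, swap_up a b), (x, a)] ws = fold fire [(x, a), (y, b)] ws"
proof -
  obtain A I R where 1: "ws = A @ I @ R" "length A = offset a" "length I = inputs a"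
    using split_window[of "offset a" "inputs a" ws] fits by auto
  have "offset b - offset a - outputs a + inputs b \<le> length R"
  proof -
    have "length ws = offset a + inputs a + length R" using 1 by simp
    moreover have "offset b + inputs b \<le> length ws - inputs a + outputs a"
      using fits unfolding fits.simps by blast
    ultimately show ?thesis using le by linarith
  qed
  then obtain M J B where 2: "R = M @ J @ B" "length M = offset b - offset a - outputs a"
      "length J = inputs b"
    using split_window[of "offset b - offset a - outputs a" "inputs b" R] by metis
  \<comment> \<open>Offsets become sums of lengths of the pieces, so that every \<open>take\<close>
    and \<open>drop\<close> cuts exactly between two pieces.\<close>
  have ob: "offset b = length A + (outputs a + length M)" using 1 2 le by simp
  have os: "offset (swap_up a b) = length A + (length I + length M)"
      "inputs (swap_up a b) = length J" "outputs (swap_up a b) = outputs b"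
    using 1 2 le by (simp_all add: swap_up_def)
  note eqs = 1(1) 1(2,3)[symmetric] 2(1) 2(3)[symmetric] ob os
  show thesis
    apply (rule that[of A I M J B])
         apply (simp add: eqs Un_ac)
        apply (simp add: eqs)
       apply (simp add: eqs)
      apply (simp add: eqs insert_commute)
     apply (simp add: eqs)
    apply (simp add: eqs)
    done
qed

section \<open>Exchanges and winding\<close>

lemma passes_fits:
  "passes x y ps ps' \<Longrightarrow> fits w (map snd ps') \<longleftrightarrow> fits w (map snd ps)"
  unfolding passes_def by (auto simp: fits_exchange)

lemma passes_labels:
  assumes "passes x y ps ps'"
  shows "fst ` set ps' = fst ` set ps" "distinct (map fst ps') \<longleftrightarrow> distinct (map fst ps)"
    "x \<in> fst ` set ps" "y \<in> fst ` set ps"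
proof -
  obtain us a b vs where "ps = us @ (x, a) # (y, b) # vs" "ps' = us @ (y, swap_up a b) # (x, a) # vs"
    using assms unfolding passes_def by blast
  then show "fst ` set ps' = fst ` set ps" "distinct (map fst ps') \<longleftrightarrow> distinct (map fst ps)"
    "x \<in> fst ` set ps" "y \<in> fst ` set ps"
    by (simp_all add: image_Un insert_commute conj_ac eq_commute)
qed

lemma fresh_mono: "fresh Y ws \<Longrightarrow> X \<subseteq> Y \<Longrightarrow> fresh X ws"
  unfolding fresh_def by blast

text \<open>The rows \<open>T\<close> of all other vertices stay. On its right, \<open>x\<close>
  sees the outputs \<open>Q\<close> of \<open>y\<close> instead of the inputs \<open>J\<close>; on
  its left, \<open>y\<close> sees the inputs \<open>I\<close> of \<open>x\<close> instead of the
  outputs \<open>P\<close>. Membership in \<open>I\<close>, \<open>J\<close>, \<open>P\<close>,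
  \<open>Q\<close> decides at which end an edge meets \<open>x\<close> or \<open>y\<close>.\<close>

lemma passes_trace:
  assumes pass: "passes x y ps ps'" and fits: "fits (length ws) (map snd ps)"
    and fresh: "fresh (fst ` set ps) ws" and dist: "distinct (map fst ps)"
  obtains A I M J B P Q T where
    "trace ws ps = insert (x, A, I, M \<union> J \<union> B) (insert (y, A \<union> P \<union> M, J, B) T)"
    "trace ws ps' = insert (x, A, I, M \<union> Q \<union> B) (insert (y, A \<union> I \<union> M, J, B) T)"
    "x \<notin> fst ` T" "y \<notin> fst ` T" "x \<noteq> y"
    "fold fire ps' ws = fold fire ps ws"
    "A \<inter> (I \<union> M \<union> J \<union> B \<union> P \<union> Q) = {}" "I \<inter> (M \<union> J \<union> B \<union> P \<union> Q) = {}"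
    "M \<inter> (J \<union> B \<union> P \<union> Q) = {}" "J \<inter> (B \<union> P \<union> Q) = {}" "B \<inter> (P \<union> Q) = {}" "P \<inter> Q = {}"
    "\<And>e t. (e, t) \<in> ends ws ps \<Longrightarrow> t = Some x \<longleftrightarrow> e \<in> I"
    "\<And>e t. (e, t) \<in> ends ws ps \<Longrightarrow> t = Some y \<longleftrightarrow> e \<in> J"
    "\<And>e t. (e, t) \<in> ends ws ps \<Longrightarrow> fst e = Some x \<longleftrightarrow> e \<in> P"
    "\<And>e t. (e, t) \<in> ends ws ps \<Longrightarrow> fst e = Some y \<longleftrightarrow> e \<in> Q"
proof -
  obtain us a b vs where le: "offset a + outputs a \<le> offset b"
    and ps: "ps = us @ [(x, a), (y, b)] @ vs"
    and ps': "ps' = us @ [(y, swap_up a b), (x, a)] @ vs"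
    using pass unfolding passes_def by auto
  let ?us = "fold fire us ws"
  have "fits (length ?us) (a # b # map snd vs)"
    using conjunct2[OF iffD1[OF fits_append fits[unfolded ps]]]
    by (simp only: append.simps list.map snd_conv)
  from exchange_window[OF le this, of x y]
  obtain A I M J B where win:
    "set ?us = set A \<union> set I \<union> set M \<union> set J \<union> set B" "distinct ?us = distinct (A @ I @ M @ J @ B)"
    "trace ?us [(x, a), (y, b)] =
       {(x, set A, set I, set (M @ J @ B)),
        (y, set (A @ map (Pair (Some x)) [0..<outputs a] @ M), set J, set B)}"
    "trace ?us [(y, swap_up a b), (x, a)] =
       {(x, set A, set I, set (M @ map (Pair (Some y)) [0..<outputs b] @ B)),
        (y, set (A @ I @ M), set J, set B)}"
    "fold fire [(y, swap_up a b), (x, a)] ?us = fold fire [(x, a), (y, b)] ?us"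
    by metis
  define P where "P = Pair (Some x) ` {0..<outputs a}"
  define Q where "Q = Pair (Some y) ` {0..<outputs b}"
  define ws' where "ws' = fold fire [(x, a), (y, b)] ?us"
  define T where "T = trace ws us \<union> trace ws' vs"
  have xy: "x \<noteq> y" using dist by (simp add: ps)
  have t1: "trace ws ps = insert (x, set A, set I, set M \<union> set J \<union> set B)
      (insert (y, set A \<union> P \<union> set M, set J, set B) T)"
    unfolding ps trace_append win(3) fold_append o_apply ws'_def[symmetric] T_def P_def
    by (simp add: Un_assoc)
  have t2: "trace ws ps' = insert (x, set A, set I, set M \<union> Q \<union> set B)
      (insert (y, set A \<union> set I \<union> set M, set J, set B) T)"
    unfolding ps' trace_append win(4) fold_append o_apply win(5) ws'_def[symmetric] T_def Q_def
    by (simp add: Un_assoc)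
  have "fst ` T = fst ` set us \<union> fst ` set vs"
    unfolding T_def image_Un fst_trace ..
  then have notin: "x \<notin> fst ` T" "y \<notin> fst ` T" using dist by (auto simp: ps)
  have "fresh ({x, y} \<union> fst ` set us) ws"
    by (rule fresh_mono[OF fresh]) (auto simp: ps)
  moreover from this have xyn: "Some x \<notin> fst ` set ws" "Some y \<notin> fst ` set ws"
    by (simp_all add: fresh_def)
  ultimately have "fresh {x, y} ?us" using dist by (intro fresh_fold) (auto simp: ps)
  then have "distinct (A @ I @ M @ J @ B)" and nin: "fst ` set ?us \<inter> {Some x, Some y} = {}"
    using win(2) by (auto simp: fresh_def)
  have "set ?us \<inter> P = {}" "set ?us \<inter> Q = {}"
    using nin by (force simp: P_def Q_def)+
  then have "set A \<inter> P = {}" "set I \<inter> P = {}" "set M \<inter> P = {}" "set J \<inter> P = {}" "set B \<inter> P = {}"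
    "set A \<inter> Q = {}" "set I \<inter> Q = {}" "set M \<inter> Q = {}" "set J \<inter> Q = {}" "set B \<inter> Q = {}"
    unfolding win(1) Int_Un_distrib2 Un_empty by simp_all
  with \<open>distinct (A @ I @ M @ J @ B)\<close> have
    disj: "set A \<inter> (set I \<union> set M \<union> set J \<union> set B \<union> P \<union> Q) = {}"
    "set I \<inter> (set M \<union> set J \<union> set B \<union> P \<union> Q) = {}"
    "set M \<inter> (set J \<union> set B \<union> P \<union> Q) = {}" "set J \<inter> (set B \<union> P \<union> Q) = {}"
    "set B \<inter> (P \<union> Q) = {}"
    by (simp_all add: Int_Un_distrib)
  have PQ: "P \<inter> Q = {}" using xy by (auto simp: P_def Q_def)
  have I: "t = Some x \<longleftrightarrow> e \<in> set I" and J: "t = Some y \<longleftrightarrow> e \<in> set J" if et: "(e, t) \<in> ends ws ps" for e t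
  proof -
    have "(e, Some x) \<in> ends ws ps" if "e \<in> set I" using that by (simp add: ends_def t1)
    moreover have "(e, Some y) \<in> ends ws ps" if "e \<in> set J" using that by (simp add: ends_def t1)
    moreover have "e \<in> set I" if "t = Some x"
      using et notin xy unfolding that ends_def t1 by force
    moreover have "e \<in> set J" if "t = Some y"
      using et notin xy unfolding that ends_def t1 by force
    ultimately show "t = Some x \<longleftrightarrow> e \<in> set I" "t = Some y \<longleftrightarrow> e \<in> set J"
      using ends_unique[OF fresh dist et] by blast+
  qed
  have src: "fst e = Some x \<longleftrightarrow> e \<in> P" "fst e = Some y \<longleftrightarrow> e \<in> Q" if et: "(e, t) \<in> ends ws ps" for e t
  proof -
    \<comment> \<open>Freshness rules out that such a port is an initial wire; distinct labels then
      identify the vertex it leaves.\<close>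
    have w: "fst e \<notin> fst ` set ws" if "fst e = Some x \<or> fst e = Some y"
      using that xyn by metis
    have a: "v = a" if "(x, v) \<in> set ps" for v
      using eq_key_imp_eq_value[OF dist that] by (simp add: ps)
    have b: "v = b" if "(y, v) \<in> set ps" for v
      using eq_key_imp_eq_value[OF dist that] by (simp add: ps)
    from ends_source[OF et] w have *: "\<exists>z v j. (z, v) \<in> set ps \<and> j < outputs v \<and> e = (Some z, j)"
      if "fst e = Some x \<or> fst e = Some y"
      using that by auto
    show "fst e = Some x \<longleftrightarrow> e \<in> P" using * a by (force simp: P_def)
    show "fst e = Some y \<longleftrightarrow> e \<in> Q" using * b by (force simp: Q_def)
  qed
  have "fold fire ps' ws = fold fire ps ws"
    unfolding ps ps' fold_append o_apply win(5) ..
  from that[OF t1 t2 notin xy this disj PQ I J src] show thesis .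
qed

text \<open>Only the left and right components of the trace change. The entering sets and the bottom
  wires, which determine \<open>ends\<close>, do not.\<close>

lemma passes_ends:
  assumes pass: "passes x y ps ps'" and fits: "fits (length ws) (map snd ps)"
    and fresh: "fresh (fst ` set ps) ws" and dist: "distinct (map fst ps)"
  shows "ends ws ps' = ends ws ps"
proof -
  obtain A I M J B P Q T where *:
    "trace ws ps = insert (x, A, I, M \<union> J \<union> B) (insert (y, A \<union> P \<union> M, J, B) T)"
    "trace ws ps' = insert (x, A, I, M \<union> Q \<union> B) (insert (y, A \<union> I \<union> M, J, B) T)"
    "fold fire ps' ws = fold fire ps ws"
    using passes_trace[OF assms] by metis
  show ?thesis unfolding ends_def * by simp
qed

section \<open>Position of a vertex relative to an edge\<close>

text \<open>\<open>1\<close> means that \<open>e\<close> passes to the left of \<open>v\<close>,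
  hence that \<open>v\<close> lies to its right. The default \<open>0\<close> also covers an edge
  that enters \<open>v\<close>.\<close>

definition side :: "('a \<times> 'a port set \<times> 'a port set \<times> 'a port set) set \<Rightarrow> 'a \<Rightarrow> 'a port \<Rightarrow> int"
  where "side T v e = (if \<exists>l m r. (v, l, m, r) \<in> T \<and> e \<in> l then 1
     else if \<exists>l m r. (v, l, m, r) \<in> T \<and> e \<in> r then -1 else 0)"

lemma side_insert:
  assumes "v \<notin> fst ` T"
  shows "side (insert (v, l, m, r) T) v e = (if e \<in> l then 1 else if e \<in> r then -1 else 0)"
proof -
  have "(v, l', m', r') \<in> insert (v, l, m, r) T \<longleftrightarrow> l' = l \<and> m' = m \<and> r' = r" for l' m' r'
    using assms by force
  then show ?thesis unfolding side_def by auto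
qed

lemma side_insert_other: "w \<noteq> v \<Longrightarrow> side (insert (w, X) T) v e = side T v e"
  unfolding side_def by auto

lemma abs_side_le: "\<bar>side T v e\<bar> \<le> 1"
  by (simp add: side_def)

text \<open>The side changes only if \<open>v\<close> is one of the exchanged vertices and
  \<open>e\<close> ends or starts at the other. If \<open>e\<close> ends there, it goes from -1 to 0
  for \<open>v = x\<close> and from 0 to 1 for \<open>v = y\<close>; if \<open>e\<close> starts
  there, it goes from 0 to -1 and from 1 to 0, respectively.\<close>

lemma passes_side:
  assumes pass: "passes x y ps ps'" and fits: "fits (length ws) (map snd ps)"
    and fresh: "fresh (fst ` set ps) ws" and dist: "distinct (map fst ps)"
    and e: "(e, t) \<in> ends ws ps" and v: "fst e \<noteq> Some v" "t \<noteq> Some v"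
  shows "side (trace ws ps') v e - side (trace ws ps) v e =
    of_bool (v \<in> {x, y} \<and> t \<in> {Some x, Some y}) - of_bool (v \<in> {x, y} \<and> fst e \<in> {Some x, Some y})"
proof (rule passes_trace[OF pass fits fresh dist])
  fix A I M J B P Q T
  assume t1: "trace ws ps = insert (x, A, I, M \<union> J \<union> B) (insert (y, A \<union> P \<union> M, J, B) T)"
    and t2: "trace ws ps' = insert (x, A, I, M \<union> Q \<union> B) (insert (y, A \<union> I \<union> M, J, B) T)"
    and xy: "x \<notin> fst ` T" "y \<notin> fst ` T" "x \<noteq> y"
    and disj: "A \<inter> (I \<union> M \<union> J \<union> B \<union> P \<union> Q) = {}" "I \<inter> (M \<union> J \<union> B \<union> P \<union> Q) = {}"
    "M \<inter> (J \<union> B \<union> P \<union> Q) = {}" "J \<inter> (B \<union> P \<union> Q) = {}" "B \<inter> (P \<union> Q) = {}" "P \<inter> Q = {}"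
    and iffs: "\<And>e t. (e, t) \<in> ends ws ps \<Longrightarrow> t = Some x \<longleftrightarrow> e \<in> I"
      "\<And>e t. (e, t) \<in> ends ws ps \<Longrightarrow> t = Some y \<longleftrightarrow> e \<in> J"
      "\<And>e t. (e, t) \<in> ends ws ps \<Longrightarrow> fst e = Some x \<longleftrightarrow> e \<in> P"
      "\<And>e t. (e, t) \<in> ends ws ps \<Longrightarrow> fst e = Some y \<longleftrightarrow> e \<in> Q"
  note iff = iffs[OF e]
  have x: "x \<notin> fst ` insert (y, X) T" for X using xy by auto
  consider "v = x" | "v = y" | "v \<noteq> x" "v \<noteq> y" by blast
  then show ?thesis
  proof cases
    case 1
    have "e \<notin> I" "e \<notin> P" using iff v 1 by auto
    then show ?thesis
      using disj unfolding t1 t2 1 side_insert[OF x] insert_iff empty_iff iff by auto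
  next
    case 2
    have "e \<notin> J" "e \<notin> Q" using iff v 2 by auto
    then show ?thesis
      using disj xy(3) unfolding t1 t2 2 side_insert_other[OF xy(3)] side_insert[OF xy(2)]
        insert_iff empty_iff iff by auto
  next
    case 3
    then show ?thesis unfolding t1 t2 by (simp add: side_insert_other)
  qed
qed

text \<open>Edges starting at the pair lie in \<open>P\<close> or \<open>Q\<close>, edges ending at
  it in \<open>I\<close> or \<open>J\<close>, and these sets are disjoint.\<close>

lemma passes_not_adjacent:
  assumes "passes x y ps ps'" "fits (length ws) (map snd ps)"
    "fresh (fst ` set ps) ws" "distinct (map fst ps)"
    and e: "(e, t) \<in> ends ws ps" "fst e \<in> {Some x, Some y}"
  shows "t \<notin> {Some x, Some y}"
proof (rule passes_trace[OF assms(1-4)])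
  fix A I M J B P Q :: "'a port set"
  assume "I \<inter> (M \<union> J \<union> B \<union> P \<union> Q) = {}" "J \<inter> (B \<union> P \<union> Q) = {}"
    and "\<And>e t. (e, t) \<in> ends ws ps \<Longrightarrow> t = Some x \<longleftrightarrow> e \<in> I"
      "\<And>e t. (e, t) \<in> ends ws ps \<Longrightarrow> t = Some y \<longleftrightarrow> e \<in> J"
      "\<And>e t. (e, t) \<in> ends ws ps \<Longrightarrow> fst e = Some x \<longleftrightarrow> e \<in> P"
      "\<And>e t. (e, t) \<in> ends ws ps \<Longrightarrow> fst e = Some y \<longleftrightarrow> e \<in> Q"
  then show ?thesis using e by blast
qed

section \<open>Bounded winding along paths\<close>

text \<open>Exchanges preserve the label set \<open>V\<close> and the edges \<open>E\<close>, so a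
  whole reduction stays inside one such set.\<close>

definition configs :: "'a port list \<Rightarrow> 'a set \<Rightarrow> ('a port \<times> 'a option) set \<Rightarrow> ('a \<times> vertex) list set"
  where "configs ws V E = {ps. fits (length ws) (map snd ps) \<and> fresh V ws \<and>
    distinct (map fst ps) \<and> fst ` set ps = V \<and> ends ws ps = E}"

lemma passes_configs:
  assumes "passes x y ps ps'" "ps \<in> configs ws V E"
  shows "ps' \<in> configs ws V E"
  using assms passes_fits[OF assms(1)] passes_labels[OF assms(1)] passes_ends[OF assms(1), of ws]
  by (auto simp: configs_def)

text \<open>
  The half turns of \<open>v\<close> around \<open>s\<close> are recorded by a function of the configuration that is bounded above;
  \<open>s = None\<close> is the boundary.
\<close>

definition bounded_winding ::
  "'a port list \<Rightarrow> 'a set \<Rightarrow> ('a port \<times> 'a option) set \<Rightarrow> 'a \<Rightarrow> 'a option \<Rightarrow> bool"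
  where "bounded_winding ws V E v s \<longleftrightarrow> (\<exists>F :: ('a \<times> vertex) list \<Rightarrow> int. \<exists>B.
    (\<forall>ps \<in> configs ws V E. F ps \<le> B) \<and> (\<forall>ps \<in> configs ws V E. \<forall>x y ps'. passes x y ps ps' \<longrightarrow>
      F ps' - F ps = of_bool (v \<in> {x, y} \<and> s \<in> {Some x, Some y})))"

lemma bounded_winding_None: "bounded_winding ws V E v None"
  unfolding bounded_winding_def by (intro exI[of _ "\<lambda>_. 0"] exI[of _ 0]) simp

text \<open>Exchanged vertices are never joined by an edge, so the count is constantly zero.\<close>

lemma bounded_winding_adjacent:
  assumes "((Some v, j), s) \<in> E \<or> ((s, j), Some v) \<in> E"
  shows "bounded_winding ws V E v s"
proof -
  have "\<not> (v \<in> {x, y} \<and> s \<in> {Some x, Some y})" if ps: "ps \<in> configs ws V E" "passes x y ps ps'"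
    for ps ps' x y
  proof
    assume "v \<in> {x, y} \<and> s \<in> {Some x, Some y}"
    then show False
      using assms passes_not_adjacent[OF ps(2), of ws] ps(1) unfolding configs_def by force
  qed
  then show ?thesis
    unfolding bounded_winding_def by (intro exI[of _ "\<lambda>_. 0"] exI[of _ 0]) auto
qed

text \<open>
  Seen from \<open>v\<close>, the two end points of an edge that avoids \<open>v\<close> wind equally often, up to the side
  of the edge on which \<open>v\<close> currently lies.
\<close>

lemma bounded_winding_step:
  assumes e: "((s, j), t) \<in> E \<or> ((t, j), s) \<in> E" and v: "s \<noteq> Some v" "t \<noteq> Some v"
    and bw: "bounded_winding ws V E v s"
  shows "bounded_winding ws V E v t"
proof -
  obtain F :: "('a \<times> vertex) list \<Rightarrow> int" and B where F: "\<And>ps. ps \<in> configs ws V E \<Longrightarrow> F ps \<le> B"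
    "\<And>ps x y ps'. ps \<in> configs ws V E \<Longrightarrow> passes x y ps ps' \<Longrightarrow>
      F ps' - F ps = of_bool (v \<in> {x, y} \<and> s \<in> {Some x, Some y})"
    using bw unfolding bounded_winding_def by blast
  have side: "side (trace ws ps') v e - side (trace ws ps) v e =
    of_bool (v \<in> {x, y} \<and> t \<in> {Some x, Some y}) - of_bool (v \<in> {x, y} \<and> fst e \<in> {Some x, Some y})"
    if "(e, t) \<in> E" "fst e \<noteq> Some v" "t \<noteq> Some v" "ps \<in> configs ws V E" "passes x y ps ps'" for e t ps ps' x y
    using that by (intro passes_side) (auto simp: configs_def)
  from e show ?thesis
  proof
    assume e: "((s, j), t) \<in> E"
    \<comment> \<open>Along an edge from \<open>s\<close> down to \<open>t\<close> the side changes
      by the half turns around \<open>t\<close> minus those around \<open>s\<close>; adding it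
      trades \<open>s\<close> for \<open>t\<close>.\<close>
    let ?G = "\<lambda>ps. F ps + side (trace ws ps) v (s, j)"
    have "?G ps \<le> B + 1" if "ps \<in> configs ws V E" for ps
      using F(1)[OF that] abs_side_le[of "trace ws ps" v "(s, j)"] by linarith
    moreover have "?G ps' - ?G ps = of_bool (v \<in> {x, y} \<and> t \<in> {Some x, Some y})"
      if "ps \<in> configs ws V E" "passes x y ps ps'" for ps ps' x y
      using F(2)[OF that] side[OF e _ _ that] v by simp
    ultimately show ?thesis unfolding bounded_winding_def by (intro exI[of _ ?G]) blast
  next
    assume e: "((t, j), s) \<in> E"
    \<comment> \<open>The edge runs from \<open>t\<close> down to \<open>s\<close>, so the side
      enters with the opposite sign.\<close>
    let ?G = "\<lambda>ps. F ps - side (trace ws ps) v (t, j)"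
    have "?G ps \<le> B + 1" if "ps \<in> configs ws V E" for ps
      using F(1)[OF that] abs_side_le[of "trace ws ps" v "(t, j)"] by linarith
    moreover have "?G ps' - ?G ps = of_bool (v \<in> {x, y} \<and> t \<in> {Some x, Some y})"
      if "ps \<in> configs ws V E" "passes x y ps ps'" for ps ps' x y
      using F(2)[OF that] side[OF e _ _ that] v by simp
    ultimately show ?thesis unfolding bounded_winding_def by (intro exI[of _ ?G]) blast
  qed
qed

text \<open>\<open>None\<close> is a source for top wires and a target for the bottom, so this
  symmetric relation covers incidence with either boundary.\<close>

definition adjacent :: "('a port \<times> 'a option) set \<Rightarrow> 'a option \<Rightarrow> 'a option \<Rightarrow> bool" where
  "adjacent E s t \<longleftrightarrow> (\<exists>j. ((s, j), t) \<in> E \<or> ((t, j), s) \<in> E)"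

definition joined :: "('a port \<times> 'a option) set \<Rightarrow> 'a \<Rightarrow> 'a \<Rightarrow> bool" where
  "joined E = (\<lambda>u v. adjacent E (Some u) (Some v))\<^sup>*\<^sup>*"

text \<open>Labelled form of \<open>boundary_connected\<close>; \<open>V \<noteq> {}\<close> mirrors
  \<open>connected\<close>, which excludes the empty graph.\<close>

definition anchored :: "'a set \<Rightarrow> ('a port \<times> 'a option) set \<Rightarrow> bool" where
  "anchored V E \<longleftrightarrow> (V \<noteq> {} \<and> (\<forall>u\<in>V. \<forall>v\<in>V. joined E u v)) \<or>
     (\<forall>u\<in>V. \<exists>v\<in>V. adjacent E None (Some v) \<and> joined E u v)"

lemma adjacent_sym: "adjacent E s t \<Longrightarrow> adjacent E t s"
  unfolding adjacent_def by blast

lemma joined_sym: "joined E u v \<Longrightarrow> joined E v u"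
  unfolding joined_def
  by (rule sympD[OF symp_rtranclp]) (auto intro!: sympI adjacent_sym)

text \<open>The alternative \<open>w = v\<close> lets the path run through \<open>v\<close>: the
  vertex after \<open>v\<close> is a neighbour of \<open>v\<close>, and
  \<open>bounded_winding_adjacent\<close> restarts the argument there.\<close>

lemma bounded_winding_joined:
  assumes "joined E u w" and "u = v \<or> bounded_winding ws V E v (Some u)"
  shows "w = v \<or> bounded_winding ws V E v (Some w)"
  using assms(1) unfolding joined_def
proof (induction rule: rtranclp_induct)
  case base
  then show ?case by (fact assms(2))
next
  case (step y z)
  then obtain j where j: "((Some y, j), Some z) \<in> E \<or> ((Some z, j), Some y) \<in> E"
    unfolding adjacent_def by blast
  show ?case
  proof (cases "z = v \<or> y = v")
    case True
    then show ?thesis using bounded_winding_adjacent[of v j "Some z" E ws V] j by blast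
  next
    case False
    then show ?thesis using bounded_winding_step[OF j] step.IH by simp
  qed
qed

lemma anchored_bounded_winding:
  assumes "anchored V E" "u \<in> V" "v \<in> V" "u \<noteq> v"
  shows "bounded_winding ws V E v (Some u)"
proof -
  consider "joined E v u" | w where "adjacent E None (Some w)" "joined E u w"
    using assms unfolding anchored_def by blast
  then show ?thesis
  proof cases
    case 1
    then show ?thesis using bounded_winding_joined[OF 1 disjI1[OF refl], of ws V] assms(4) by simp
  next
    case 2
    obtain j where j: "((None, j), Some w) \<in> E \<or> ((Some w, j), None) \<in> E"
      using 2(1) unfolding adjacent_def by blast
    \<comment> \<open>The zero winding around the boundary is carried over the boundary edge to
      \<open>w\<close>.\<close>
    have "w = v \<or> bounded_winding ws V E v (Some w)"
      using bounded_winding_step[OF j _ _ bounded_winding_None, of v] by auto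
    from bounded_winding_joined[OF joined_sym[OF 2(2)] this] show ?thesis using assms(4) by simp
  qed
qed

text \<open>The potential sums the slack \<open>B u v - F u v ps\<close> over ordered pairs of
  distinct vertices. An exchange of \<open>x\<close> and \<open>y\<close> lowers both summands of
  this pair by one and keeps all others.\<close>

lemma configs_potential:
  assumes "anchored V E" "finite V"
  obtains \<Phi> :: "('a \<times> vertex) list \<Rightarrow> nat" where
    "\<And>ps ps' x y. ps \<in> configs ws V E \<Longrightarrow> passes x y ps ps' \<Longrightarrow> \<Phi> ps' < \<Phi> ps"
proof -
  define R where "R v u F B \<longleftrightarrow> (\<forall>ps \<in> configs ws V E. F ps \<le> B) \<and>
    (\<forall>ps \<in> configs ws V E. \<forall>x y ps'. passes x y ps ps' \<longrightarrow>
      F ps' - F ps = of_bool (v \<in> {x, y} \<and> Some u \<in> {Some x, Some y}))"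
    for v u and F :: "('a \<times> vertex) list \<Rightarrow> int" and B
  have "\<exists>F B. R v u F B" if "u \<in> V" "v \<in> V" "u \<noteq> v" for u v
    using anchored_bounded_winding[OF assms(1) that, of ws] unfolding bounded_winding_def R_def .
  \<comment> \<open>Guarding by implications makes existence total in \<open>u\<close> and
    \<open>v\<close>, so that functions \<open>F\<close> and \<open>B\<close> can be chosen.\<close>
  then have ex: "\<forall>u v. \<exists>F. \<exists>B. u \<in> V \<longrightarrow> v \<in> V \<longrightarrow> u \<noteq> v \<longrightarrow> R v u F B" by blast
  obtain F B where "\<forall>u v. u \<in> V \<longrightarrow> v \<in> V \<longrightarrow> u \<noteq> v \<longrightarrow> R v u (F u v) (B u v)"
    using ex unfolding choice_iff by (elim exE) (rule that)
  then have R: "R v u (F u v) (B u v)" if "u \<in> V" "v \<in> V" "u \<noteq> v" for u v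
    using that by simp
  have FB: "F u v ps \<le> B u v" if "u \<in> V" "v \<in> V" "u \<noteq> v" "ps \<in> configs ws V E" for u v ps
    using R[OF that(1-3)] that(4) unfolding R_def by simp
  have FS: "F u v ps' - F u v ps = of_bool (v \<in> {x, y} \<and> Some u \<in> {Some x, Some y})"
    if "u \<in> V" "v \<in> V" "u \<noteq> v" "ps \<in> configs ws V E" "passes x y ps ps'" for u v ps x y ps'
    using R[OF that(1-3)] that(4,5) unfolding R_def by simp
  define X where "X = {(v, u). v \<in> V \<and> u \<in> V \<and> u \<noteq> v}"
  have "finite X" using finite_subset[of X "V \<times> V"] assms(2) by (auto simp: X_def)
  define \<Psi> where "\<Psi> ps = (\<Sum>(v, u)\<in>X. B u v - F u v ps)" for ps
  have nonneg: "0 \<le> \<Psi> ps" if "ps \<in> configs ws V E" for ps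
    unfolding \<Psi>_def using FB that by (intro sum_nonneg) (auto simp: X_def)
  show thesis
  proof (rule that[of "\<lambda>ps. nat (\<Psi> ps)"])
    fix ps ps' x y assume ps: "ps \<in> configs ws V E" "passes x y ps ps'"
    have "x \<noteq> y" using ps unfolding configs_def passes_def by auto
    then have xy: "(x, y) \<in> X" using ps passes_labels[OF ps(2)] by (auto simp: X_def configs_def)
    have "\<Psi> ps' < \<Psi> ps"
      unfolding \<Psi>_def
    proof (rule sum_strict_mono_ex1[OF \<open>finite X\<close>])
      show "\<forall>p\<in>X. (case p of (v, u) \<Rightarrow> B u v - F u v ps') \<le> (case p of (v, u) \<Rightarrow> B u v - F u v ps)"
      proof clarify
        fix v u assume "(v, u) \<in> X"
        then have "F u v ps' - F u v ps = of_bool (v \<in> {x, y} \<and> Some u \<in> {Some x, Some y})"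
          using FS[of u v, OF _ _ _ ps] by (auto simp: X_def)
        then have "F u v ps' - F u v ps \<ge> 0" by simp
        then show "B u v - F u v ps' \<le> B u v - F u v ps" by simp
      qed
      show "\<exists>p\<in>X. (case p of (v, u) \<Rightarrow> B u v - F u v ps') < (case p of (v, u) \<Rightarrow> B u v - F u v ps)"
        using FS[of y x, OF _ _ _ ps] xy by (intro bexI[OF _ xy]) (auto simp: X_def)
    qed
    then show "nat (\<Psi> ps') < nat (\<Psi> ps)"
      using nonneg[OF passes_configs[OF ps(2,1)]] by simp
  qed
qed

section \<open>The underlying graph in terms of labels\<close>

definition top_wires :: "diagram \<Rightarrow> 'a port list" where
  "top_wires D = map (Pair None) [0..<source D]"

section \<open>Wire chains and edges\<close>

lemma continues_level: "continues D p q \<Longrightarrow> fst q = Suc (fst p)"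
  unfolding continues_def by auto

lemma continues_wires: "continues D p q \<Longrightarrow> p \<in> wires D \<and> q \<in> wires D"
  unfolding continues_def by blast

lemma continues_functional: "continues D p q \<Longrightarrow> continues D p q' \<Longrightarrow> q = q'"
  unfolding continues_def by auto

lemma continues_injective: "continues D p q \<Longrightarrow> continues D p' q \<Longrightarrow> p = p'"
  unfolding continues_def Delta_def by auto

lemma not_continues_output: "q \<in> output_wires D u \<Longrightarrow> \<not> continues D p q"
  unfolding continues_def Delta_def output_wires_def by auto

lemma not_continues_input: "p \<in> input_wires D v \<Longrightarrow> \<not> continues D p q"
  unfolding continues_def Delta_def input_wires_def by auto

lemma rtranclp_continues_wires:
  assumes "(continues D)\<^sup>*\<^sup>* p q"
  shows "p \<in> wires D \<longleftrightarrow> q \<in> wires D"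
  using assms by induction (auto dest: continues_wires)

text \<open>\<open>continues\<close> is functional, so the wires reached from \<open>p\<close> form
  a chain; injectivity gives the upward version below.\<close>

lemma rtranclp_continues_down_linear:
  assumes "(continues D)\<^sup>*\<^sup>* p q" "(continues D)\<^sup>*\<^sup>* p r"
  shows "(continues D)\<^sup>*\<^sup>* q r \<or> (continues D)\<^sup>*\<^sup>* r q"
  using assms
proof (induction rule: rtranclp_induct)
  case (step y z)
  then consider "(continues D)\<^sup>*\<^sup>* y r" | "(continues D)\<^sup>*\<^sup>* r y" by blast
  then show ?case
  proof cases
    case 1
    then show ?thesis
      by (cases rule: converse_rtranclpE) (use step.hyps continues_functional in blast)+
  next
    case 2
    then show ?thesis using step.hyps by (meson rtranclp.rtrancl_into_rtrancl)
  qed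
qed blast

lemma rtranclp_continues_up_linear:
  assumes "(continues D)\<^sup>*\<^sup>* p r" "(continues D)\<^sup>*\<^sup>* q r"
  shows "(continues D)\<^sup>*\<^sup>* p q \<or> (continues D)\<^sup>*\<^sup>* q p"
  using assms
proof (induction arbitrary: q rule: converse_rtranclp_induct)
  case (step y z)
  then consider "(continues D)\<^sup>*\<^sup>* z q" | "(continues D)\<^sup>*\<^sup>* q z" by blast
  then show ?case
  proof cases
    case 1
    then show ?thesis using step.hyps by (meson converse_rtranclp_into_rtranclp)
  next
    case 2
    then show ?thesis
      by (cases rule: rtranclp.cases) (use step.hyps continues_injective in blast)+
  qed
qed blast

lemma edge_wires: "e \<in> edges D \<Longrightarrow> e \<subseteq> wires D"
  unfolding edges_def pred_on.maxchain_def pred_on.chain_def by blast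

lemma edge_linear:
  assumes "e \<in> edges D" "p \<in> e" "q \<in> e"
  shows "(continues D)\<^sup>*\<^sup>* p q \<or> (continues D)\<^sup>*\<^sup>* q p"
  using assms unfolding edges_def pred_on.maxchain_def pred_on.chain_def
  unfolding reflclp_tranclp by blast

text \<open>The wires comparable with \<open>p\<close> form a chain by the two linearity lemmas. A
  chain including them contains \<open>p\<close>, so all its members are comparable with
  \<open>p\<close>, which gives maximality.\<close>

lemma edge_through:
  assumes "p \<in> wires D"
  shows "{q. (continues D)\<^sup>*\<^sup>* q p \<or> (continues D)\<^sup>*\<^sup>* p q} \<in> edges D"
proof -
  let ?e = "{q. (continues D)\<^sup>*\<^sup>* q p \<or> (continues D)\<^sup>*\<^sup>* p q}"
  have "pred_on.chain (wires D) ((continues D)\<^sup>+\<^sup>+) ?e"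
  proof (rule pred_on.chainI)
    show "?e \<subseteq> wires D"
    proof
      fix q assume "q \<in> ?e"
      then show "q \<in> wires D"
        using assms rtranclp_continues_wires[of D q p] rtranclp_continues_wires[of D p q] by blast
    qed
    fix q r assume "q \<in> ?e" "r \<in> ?e"
    then have "(continues D)\<^sup>*\<^sup>* q r \<or> (continues D)\<^sup>*\<^sup>* r q"
      using rtranclp_continues_down_linear[of D p q r] rtranclp_continues_up_linear[of D q p r]
        rtranclp_trans[of "continues D" q p r] rtranclp_trans[of "continues D" r p q] by blast
    then show "((continues D)\<^sup>+\<^sup>+)\<^sup>=\<^sup>= q r \<or> ((continues D)\<^sup>+\<^sup>+)\<^sup>=\<^sup>= r q"
      unfolding reflclp_tranclp .
  qed
  moreover have "S \<subseteq> ?e" if "pred_on.chain (wires D) ((continues D)\<^sup>+\<^sup>+) S" "?e \<subseteq> S" for S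
  proof
    fix q assume "q \<in> S"
    moreover have "p \<in> S" using that(2) by blast
    ultimately show "q \<in> ?e"
      using that(1) unfolding pred_on.chain_def reflclp_tranclp by blast
  qed
  ultimately show ?thesis
    unfolding edges_def pred_on.maxchain_def by blast
qed

text \<open>\<open>P\<close> and \<open>Q\<close> are arbitrary so that it serves input wires,
  output wires and single boundary wires alike.\<close>

lemma edge_output_input_iff:
  assumes "q \<in> wires D \<or> p \<in> wires D" "p \<in> P" "q \<in> Q" "(continues D)\<^sup>*\<^sup>* p q"
  shows "\<exists>e \<in> edges D. e \<inter> P \<noteq> {} \<and> e \<inter> Q \<noteq> {}"
proof -
  have "p \<in> wires D" using assms rtranclp_continues_wires by blast
  from edge_through[OF this] show ?thesis
    by (rule bexI[rotated]) (use assms in auto)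
qed

section \<open>Ports of the wires of a diagram\<close>

text \<open>\<open>ls ! n\<close> names the vertex at height \<open>n\<close>. The labels are
  arbitrary because exchanges permute heights while labels stay with their vertices.\<close>

locale labelled_diagram =
  fixes D :: diagram and ls :: "'a list"
  assumes val: "valid D" and dist: "distinct ls" and len: "length ls = num_vertices D"
begin

abbreviation "xs \<equiv> zip ls (vertices D)"
text \<open>Entry \<open>k\<close> is the port at which the edge through wire \<open>(n, k)\<close>
  starts.\<close>

definition "st n = fold fire (take n xs) (top_wires D)"

lemma xs_nth: "n < num_vertices D \<Longrightarrow> xs ! n = (ls ! n, vertices D ! n)"
  using len by (simp add: num_vertices_def)

lemma length_xs: "length xs = num_vertices D"
  using len by (simp add: num_vertices_def)

lemma st_0: "st 0 = top_wires D"
  by (simp add: st_def)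

lemma st_Suc: "n < num_vertices D \<Longrightarrow> st (Suc n) = take (H_of D n) (st n) @
    map (Pair (Some (ls ! n))) [0..<O_of D n] @ drop (H_of D n + I_of D n) (st n)"
  unfolding st_def using xs_nth[of n] length_xs
  by (simp add: take_Suc_conv_app_nth H_of_def I_of_def O_of_def)

lemma length_st: "n \<le> num_vertices D \<Longrightarrow> int (length (st n)) = W D n"
proof (induction n)
  case (Suc n)
  then have "W D n \<ge> int (H_of D n) + int (I_of D n)" "int (length (st n)) = W D n"
    using val by (simp_all add: valid_def)
  then show ?case using Suc by (simp add: st_Suc Delta_def)
qed (simp add: st_0 top_wires_def)

lemma window:
  assumes "n < num_vertices D"
  shows "H_of D n + I_of D n \<le> length (st n)"
proof -
  have "int (H_of D n) + int (I_of D n) \<le> W D n" using val assms by (simp add: valid_def)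
  then show ?thesis using length_st[of n] assms by linarith
qed

lemma wires_iff: "(n, k) \<in> wires D \<longleftrightarrow> n \<le> num_vertices D \<and> k < length (st n)"
  using length_st[of n] by (auto simp: wires_def)

lemma st_continues:
  assumes "continues D (n, k) (m, j)"
  shows "st m ! j = st n ! k"
proof -
  have m: "m = Suc n" and n: "n < num_vertices D"
    using continues_level[OF assms] continues_wires[OF assms] by (auto simp: wires_def)
  have k: "k < length (st n)" using continues_wires[OF assms] by (simp add: wires_iff)
  have "k < H_of D n \<and> j = k \<or> k \<ge> H_of D n + I_of D n \<and> int j = int k + Delta D n"
    using assms by (simp add: continues_def m)
  then show ?thesis
  proof
    assume "k < H_of D n \<and> j = k"
    then show ?thesis using window[OF n] by (simp add: m st_Suc[OF n] nth_append)
  next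
    assume *: "k \<ge> H_of D n + I_of D n \<and> int j = int k + Delta D n"
    then obtain i where i: "k = H_of D n + I_of D n + i" using le_Suc_ex by blast
    then have "j = H_of D n + (O_of D n + i)" using * by (simp add: Delta_def)
    then show ?thesis using window[OF n] k by (simp add: m st_Suc[OF n] nth_append i)
  qed
qed

lemma st_rtranclp_continues:
  "(continues D)\<^sup>*\<^sup>* p q \<Longrightarrow> st (fst q) ! snd q = st (fst p) ! snd p"
  by (induction rule: rtranclp_induct) (auto dest: st_continues)

lemma st_output:
  "u < num_vertices D \<Longrightarrow> j < O_of D u \<Longrightarrow> st (Suc u) ! (H_of D u + j) = (Some (ls ! u), j)"
  using window[of u] by (simp add: st_Suc nth_append)

text \<open>\<open>p\<close> is the first wire of the edge starting at port \<open>e\<close>; the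
  outputs of vertex \<open>u\<close> lie on level \<open>Suc u\<close>.\<close>

definition origin :: "'a port \<Rightarrow> nat \<times> nat \<Rightarrow> bool" where
  "origin e p \<longleftrightarrow> (\<exists>k. e = (None, k) \<and> k < source D \<and> p = (0, k)) \<or>
     (\<exists>u j. u < num_vertices D \<and> j < O_of D u \<and> e = (Some (ls ! u), j) \<and> p = (Suc u, H_of D u + j))"

text \<open>Follow the wire upwards: it continues a wire one level higher unless it lies on level 0
  or is an output of the vertex just above.\<close>

lemma st_origin:
  "(n, k) \<in> wires D \<Longrightarrow> \<exists>p. origin (st n ! k) p \<and> (continues D)\<^sup>*\<^sup>* p (n, k)"
proof (induction n arbitrary: k)
  case 0
  then have "origin (st 0 ! k) (0, k)" by (simp add: origin_def wires_iff st_0 top_wires_def)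
  then show ?case by blast
next
  case (Suc n)
  then have n: "n < num_vertices D" and k: "k < length (st (Suc n))" by (auto simp: wires_iff)
  have step: ?case if "continues D (n, i) (Suc n, k)" for i
    using Suc.IH[of i] st_continues[OF that] continues_wires[OF that] that
    by (metis rtranclp.rtrancl_into_rtrancl)
  have w: "W D (Suc n) = W D n + Delta D n" by simp
  consider "k < H_of D n" | j where "k = H_of D n + j" "j < O_of D n" | "k \<ge> H_of D n + O_of D n"
    by (metis add.commute add_less_cancel_left le_Suc_ex linorder_not_less)
  then show ?case
  proof cases
    case 1
    then have "continues D (n, k) (Suc n, k)"
      using Suc.prems n window[OF n] by (auto simp: continues_def wires_iff)
    then show ?thesis by (rule step)
  next
    case 2
    then have "origin (st (Suc n) ! k) (Suc n, k)" using n st_output by (auto simp: origin_def)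
    then show ?thesis by blast
  next
    case 3
    \<comment> \<open>The wire that continues as \<open>k\<close> to the right of the vertex;
      \<open>k \<ge> O_of D n\<close> makes the subtraction exact.\<close>
    define i where "i = k - O_of D n + I_of D n"
    have "i < length (st n)"
      using k 3 window[OF n] by (simp add: st_Suc[OF n] i_def)
    then have "continues D (n, i) (Suc n, k)"
      using Suc.prems n 3 by (auto simp: continues_def wires_iff i_def Delta_def)
    then show ?thesis by (rule step)
  qed
qed

lemma trace_iff: "(x, l, m, r) \<in> trace (top_wires D) xs \<longleftrightarrow> (\<exists>n < num_vertices D. x = ls ! n \<and>
    l = set (take (H_of D n) (st n)) \<and> m = set (take (I_of D n) (drop (H_of D n) (st n))) \<and>
    r = set (drop (H_of D n + I_of D n) (st n)))"
proof -
  \<comment> \<open>The induction runs over prefixes: a vertex appended after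
    \<open>take k xs\<close> fires from \<open>st k\<close>.\<close>
  have "t \<in> trace (top_wires D) (take k xs) \<longleftrightarrow> (\<exists>n < k. t = (ls ! n,
    set (take (H_of D n) (st n)), set (take (I_of D n) (drop (H_of D n) (st n))),
    set (drop (H_of D n + I_of D n) (st n))))" if "k \<le> num_vertices D" for k t
    using that
  proof (induction k)
    case (Suc k)
    then have "take (Suc k) xs = take k xs @ [(ls ! k, vertices D ! k)]"
      using xs_nth[of k] length_xs by (simp add: take_Suc_conv_app_nth)
    then show ?case
      using Suc by (auto simp: trace_append st_def H_of_def I_of_def less_Suc_eq)
  qed simp
  from this[of "num_vertices D" "(x, l, m, r)"] length_xs show ?thesis by simp
qed

lemma input_label_iff:
  assumes "v < num_vertices D"
  shows "(e, Some (ls ! v)) \<in> ends (top_wires D) xs \<longleftrightarrow> (\<exists>k. (v, k) \<in> input_wires D v \<and> st v ! k = e)"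
proof -
  have "(e, Some (ls ! v)) \<in> ends (top_wires D) xs \<longleftrightarrow>
      (\<exists>l m r. (ls ! v, l, m, r) \<in> trace (top_wires D) xs \<and> e \<in> m)"
    unfolding ends_def by force
  also have "\<dots> \<longleftrightarrow> e \<in> set (take (I_of D v) (drop (H_of D v) (st v)))"
    using assms dist len unfolding trace_iff by (auto simp: nth_eq_iff_index_eq)
  also have "\<dots> \<longleftrightarrow> (\<exists>i < I_of D v. st v ! (H_of D v + i) = e)"
    using window[OF assms] by (auto simp: in_set_conv_nth)
  also have "\<dots> \<longleftrightarrow> (\<exists>k. (v, k) \<in> input_wires D v \<and> st v ! k = e)"
    unfolding input_wires_def by (auto simp: le_iff_add)
  finally show ?thesis .
qed

lemma bottom_label_iff:
  "(e, None) \<in> ends (top_wires D) xs \<longleftrightarrow>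
     (\<exists>k. (num_vertices D, k) \<in> wires D \<and> st (num_vertices D) ! k = e)"
proof -
  have "(e, None) \<in> ends (top_wires D) xs \<longleftrightarrow> e \<in> set (st (num_vertices D))"
    unfolding ends_def st_def using length_xs by auto
  then show ?thesis by (auto simp: wires_iff in_set_conv_nth)
qed

lemma input_wire: "v < num_vertices D \<Longrightarrow> (v, k) \<in> input_wires D v \<Longrightarrow> (v, k) \<in> wires D"
  using window[of v] by (auto simp: input_wires_def wires_iff)

lemma output_wire: "u < num_vertices D \<Longrightarrow> p \<in> output_wires D u \<Longrightarrow> p \<in> wires D"
  using window[of u] by (auto simp: output_wires_def wires_iff st_Suc)

text \<open>Ports are constant along a chain. Conversely, \<open>st_origin\<close> traces
  \<open>q\<close> back to the wire at its port, and distinct labels place that wire among the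
  outputs of \<open>u\<close>.\<close>

lemma path_from_output_iff:
  assumes u: "u < num_vertices D" and q: "q \<in> wires D"
  shows "(\<exists>p \<in> output_wires D u. (continues D)\<^sup>*\<^sup>* p q) \<longleftrightarrow> (\<exists>j. st (fst q) ! snd q = (Some (ls ! u), j))"
proof
  assume "\<exists>p \<in> output_wires D u. (continues D)\<^sup>*\<^sup>* p q"
  then obtain k where k: "(Suc u, k) \<in> output_wires D u" "(continues D)\<^sup>*\<^sup>* (Suc u, k) q"
    by (auto simp: output_wires_def)
  then obtain j where "k = H_of D u + j" "j < O_of D u"
    by (auto simp: output_wires_def le_iff_add)
  then show "\<exists>j. st (fst q) ! snd q = (Some (ls ! u), j)"
    using st_rtranclp_continues[OF k(2)] st_output[OF u] by auto
next
  assume "\<exists>j. st (fst q) ! snd q = (Some (ls ! u), j)"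
  then obtain j p where p: "origin (Some (ls ! u), j) p" "(continues D)\<^sup>*\<^sup>* p q"
    using st_origin[of "fst q" "snd q"] q by auto
  then have "p \<in> output_wires D u"
    using u dist len by (auto simp: origin_def output_wires_def nth_eq_iff_index_eq)
  with p show "\<exists>p \<in> output_wires D u. (continues D)\<^sup>*\<^sup>* p q" by blast
qed

lemma path_from_top_iff:
  assumes q: "q \<in> wires D"
  shows "(\<exists>k. (continues D)\<^sup>*\<^sup>* (0, k) q) \<longleftrightarrow> (\<exists>j. st (fst q) ! snd q = (None, j))"
proof
  assume "\<exists>k. (continues D)\<^sup>*\<^sup>* (0, k) q"
  then obtain k where k: "(continues D)\<^sup>*\<^sup>* (0, k) q" by blast
  then have "(0, k) \<in> wires D" using q rtranclp_continues_wires by blast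
  then show "\<exists>j. st (fst q) ! snd q = (None, j)"
    using st_rtranclp_continues[OF k] by (simp add: wires_iff st_0 top_wires_def)
next
  assume "\<exists>j. st (fst q) ! snd q = (None, j)"
  then show "\<exists>k. (continues D)\<^sup>*\<^sup>* (0, k) q"
    using st_origin[of "fst q" "snd q"] q by (auto simp: origin_def)
qed

lemma arc_iff:
  assumes u: "u < num_vertices D" and v: "v < num_vertices D"
  shows "(\<exists>e \<in> edges D. e \<inter> output_wires D u \<noteq> {} \<and> e \<inter> input_wires D v \<noteq> {}) \<longleftrightarrow>
    (\<exists>j. ((Some (ls ! u), j), Some (ls ! v)) \<in> ends (top_wires D) xs)" (is "?L \<longleftrightarrow> ?R")
proof -
  have "?L \<longleftrightarrow> (\<exists>q \<in> input_wires D v. \<exists>p \<in> output_wires D u. (continues D)\<^sup>*\<^sup>* p q)"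
  proof
    assume ?L
    then obtain e p q where e: "e \<in> edges D" "p \<in> e" "q \<in> e" "p \<in> output_wires D u" "q \<in> input_wires D v"
      by blast
    \<comment> \<open>Nothing continues into an output wire, so the chain through \<open>p\<close>
      and \<open>q\<close> can only run down from \<open>p\<close>.\<close>
    have "(continues D)\<^sup>*\<^sup>* p q"
      using edge_linear[OF e(1-3)] not_continues_output[OF e(4)] by (metis rtranclp.cases)
    then show "\<exists>q \<in> input_wires D v. \<exists>p \<in> output_wires D u. (continues D)\<^sup>*\<^sup>* p q"
      using e by blast
  next
    assume "\<exists>q \<in> input_wires D v. \<exists>p \<in> output_wires D u. (continues D)\<^sup>*\<^sup>* p q"
    then obtain p q where *: "p \<in> output_wires D u" "q \<in> input_wires D v" "(continues D)\<^sup>*\<^sup>* p q"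
      by blast
    show ?L by (rule edge_output_input_iff[OF disjI2[OF output_wire[OF u *(1)]] *])
  qed
  also have "\<dots> \<longleftrightarrow> (\<exists>k. (v, k) \<in> input_wires D v \<and> (\<exists>j. st v ! k = (Some (ls ! u), j)))"
  proof -
    have "(\<exists>p \<in> output_wires D u. (continues D)\<^sup>*\<^sup>* p (v, k)) \<longleftrightarrow> (\<exists>j. st v ! k = (Some (ls ! u), j))"
      if "(v, k) \<in> input_wires D v" for k
      using path_from_output_iff[OF u input_wire[OF v that]] by simp
    moreover have "(\<exists>q \<in> input_wires D v. R q) \<longleftrightarrow> (\<exists>k. (v, k) \<in> input_wires D v \<and> R (v, k))" for R
      by (auto simp: input_wires_def)
    ultimately show ?thesis by (simp cong: conj_cong)
  qed
  also have "\<dots> \<longleftrightarrow> ?R" unfolding input_label_iff[OF v] by auto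
  finally show ?thesis .
qed

text \<open>An edge from the top can meet \<open>v\<close> only at an input and an edge to the
  bottom only at an output; these are the two alternatives of \<open>adjacent\<close> with
  \<open>None\<close>.\<close>

lemma boundary_vertex_iff:
  assumes v: "v < num_vertices D"
  shows "boundary_vertex D v \<longleftrightarrow> adjacent (ends (top_wires D) xs) None (Some (ls ! v))"
proof -
  have "boundary_vertex D v \<longleftrightarrow>
    (\<exists>k. (v, k) \<in> input_wires D v \<and> (\<exists>i. (continues D)\<^sup>*\<^sup>* (0, i) (v, k))) \<or>
    (\<exists>k. (num_vertices D, k) \<in> wires D \<and> (\<exists>p \<in> output_wires D v. (continues D)\<^sup>*\<^sup>* p (num_vertices D, k)))"
    (is "_ \<longleftrightarrow> ?top \<or> ?bottom")
  proof
    assume "boundary_vertex D v"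
    then obtain e p where e: "e \<in> edges D" "reaches_boundary D e" "p \<in> e"
        "p \<in> input_wires D v \<or> p \<in> output_wires D v"
      unfolding boundary_vertex_def by blast
    have top: "(continues D)\<^sup>*\<^sup>* (0, i) p" if "(0, i) \<in> e" for i
      using edge_linear[OF e(1) that e(3)] by (metis fst_conv nat.simps(3) continues_level rtranclp.cases)
    have bottom: "(continues D)\<^sup>*\<^sup>* p (num_vertices D, i) \<and> (num_vertices D, i) \<in> wires D"
      if "(num_vertices D, i) \<in> e" for i
    proof -
      have "\<not> continues D (num_vertices D, i) q" for q
        by (cases q) (auto simp: continues_def wires_def)
      then have "(continues D)\<^sup>*\<^sup>* p (num_vertices D, i)"
        using edge_linear[OF e(1) that e(3)] by (metis converse_rtranclpE)
      then show ?thesis using edge_wires[OF e(1)] that by blast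
    qed
    from e(2) consider i where "(0, i) \<in> e" | i where "(num_vertices D, i) \<in> e"
      unfolding reaches_boundary_def by blast
    then show "?top \<or> ?bottom"
    proof cases
      case 1
      \<comment> \<open>With nothing above it, an output wire on this edge would itself lie on level
        0.\<close>
      have "p \<notin> output_wires D v"
      proof
        assume p: "p \<in> output_wires D v"
        then have "p = (0, i)" using top[OF 1] not_continues_output by (metis rtranclp.cases)
        then show False using p by (simp add: output_wires_def)
      qed
      then obtain k where "p = (v, k)" "(v, k) \<in> input_wires D v"
        using e(4) by (auto simp: input_wires_def)
      then show ?thesis using top[OF 1] by blast
    next
      case 2
      \<comment> \<open>With nothing below it, an input wire on this edge would lie on the bottom
        level, below \<open>v\<close>.\<close>
      have "p \<notin> input_wires D v"
      proof
        assume p: "p \<in> input_wires D v"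
        then have "p = (num_vertices D, i)"
          using bottom[OF 2] not_continues_input by (metis converse_rtranclpE)
        then show False using p v by (simp add: input_wires_def)
      qed
      then show ?thesis using bottom[OF 2] e(4) by blast
    qed
  next
    assume "?top \<or> ?bottom"
    then show "boundary_vertex D v"
    proof
      assume ?top
      then obtain k i where *: "(v, k) \<in> input_wires D v" "(continues D)\<^sup>*\<^sup>* (0, i) (v, k)" by blast
      from edge_output_input_iff[OF _ _ *(1) *(2), of "{(0, i)}"] input_wire[OF v *(1)]
      show ?thesis unfolding boundary_vertex_def reaches_boundary_def using v by blast
    next
      assume ?bottom
      then obtain k p where *: "(num_vertices D, k) \<in> wires D" "p \<in> output_wires D v"
        "(continues D)\<^sup>*\<^sup>* p (num_vertices D, k)" by blast
      from edge_output_input_iff[OF _ *(2) _ *(3), of "{(num_vertices D, k)}"] *(1)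
      show ?thesis unfolding boundary_vertex_def reaches_boundary_def using v by blast
    qed
  qed
  also have "\<dots> \<longleftrightarrow> (\<exists>k. (v, k) \<in> input_wires D v \<and> (\<exists>j. st v ! k = (None, j))) \<or>
    (\<exists>k. (num_vertices D, k) \<in> wires D \<and> (\<exists>j. st (num_vertices D) ! k = (Some (ls ! v), j)))"
    (is "_ \<longleftrightarrow> ?top' \<or> ?bottom'")
  proof -
    have "(\<exists>i. (continues D)\<^sup>*\<^sup>* (0, i) (v, k)) \<longleftrightarrow> (\<exists>j. st v ! k = (None, j))"
      if "(v, k) \<in> input_wires D v" for k
      using path_from_top_iff[OF input_wire[OF v that]] by simp
    then have "?top \<longleftrightarrow> ?top'" by blast
    moreover have "(\<exists>p \<in> output_wires D v. (continues D)\<^sup>*\<^sup>* p (num_vertices D, k)) \<longleftrightarrow>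
        (\<exists>j. st (num_vertices D) ! k = (Some (ls ! v), j))" if "(num_vertices D, k) \<in> wires D" for k
      using path_from_output_iff[OF v that] by simp
    then have "?bottom \<longleftrightarrow> ?bottom'" by blast
    ultimately show ?thesis by (simp only:)
  qed
  also have "\<dots> \<longleftrightarrow> adjacent (ends (top_wires D) xs) None (Some (ls ! v))"
    unfolding adjacent_def input_label_iff[OF v] bottom_label_iff by blast
  finally show ?thesis .
qed

end

lemma set_ends_labels:
  assumes "((s, j), Some y) \<in> ends (top_wires D) ps"
  shows "y \<in> fst ` set ps" "s = Some x \<Longrightarrow> x \<in> fst ` set ps"
proof -
  show "y \<in> fst ` set ps" by (rule ends_target[OF assms])
  show "x \<in> fst ` set ps" if "s = Some x"
    using ends_source[OF assms] that by (force simp: top_wires_def)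
qed

section \<open>Connectivity in terms of ports\<close>

context labelled_diagram begin

lemma labels_xs: "map fst xs = ls" "fst ` set xs = set ls"
proof -
  show "map fst xs = ls" using len by (simp add: num_vertices_def)
  then show "fst ` set xs = set ls" by (metis set_map)
qed

abbreviation "E \<equiv> ends (top_wires D) xs"

lemma adjacent_labels: "adjacent E (Some x) (Some y) \<Longrightarrow> x \<in> set ls \<and> y \<in> set ls"
  unfolding adjacent_def using set_ends_labels[of _ _ _ D xs] labels_xs(2) by blast

lemma arcs_ends_iff: "(u, v) \<in> arcs_ends (with_proj (mk_symmetric (underlying_graph D))) \<longleftrightarrow>
    u < num_vertices D \<and> v < num_vertices D \<and> adjacent E (Some (ls ! u)) (Some (ls ! v))"
proof -
  let ?arc = "\<lambda>u v. u < num_vertices D \<and> v < num_vertices D \<and>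
    (\<exists>e \<in> edges D. e \<inter> output_wires D u \<noteq> {} \<and> e \<inter> input_wires D v \<noteq> {})"
  have "(u, v) \<in> arcs_ends (with_proj (mk_symmetric (underlying_graph D))) \<longleftrightarrow> ?arc u v \<or> ?arc v u"
    unfolding underlying_graph_def by (auto simp: parcs_mk_symmetric)
  also have "\<dots> \<longleftrightarrow> u < num_vertices D \<and> v < num_vertices D \<and>
      ((\<exists>j. ((Some (ls ! u), j), Some (ls ! v)) \<in> E) \<or> (\<exists>j. ((Some (ls ! v), j), Some (ls ! u)) \<in> E))"
    by (cases "u < num_vertices D \<and> v < num_vertices D") (auto simp: arc_iff)
  finally show ?thesis unfolding adjacent_def by auto
qed

lemma joined_by_path_iff:
  assumes u: "u < num_vertices D" and v: "v < num_vertices D"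
  shows "joined_by_path D u v \<longleftrightarrow> joined E (ls ! u) (ls ! v)"
proof
  let ?A = "arcs_ends (with_proj (mk_symmetric (underlying_graph D)))"
  let ?V = "verts (with_proj (mk_symmetric (underlying_graph D)))"
  have V: "?V = {..<num_vertices D}" by (simp add: underlying_graph_def)
  show "joined E (ls ! u) (ls ! v)" if "joined_by_path D u v"
  proof -
    have "(u, v) \<in> ?A\<^sup>*"
      using that unfolding joined_by_path_def by (rule reachable_rtranclI)
    then show ?thesis
      unfolding joined_def
    proof induction
      case (step y z)
      then have "adjacent E (Some (ls ! y)) (Some (ls ! z))" using arcs_ends_iff by blast
      with step.IH show ?case by (rule rtranclp.rtrancl_into_rtrancl)
    qed simp
  qed
  \<comment> \<open>\<open>reachable\<close> stays inside the vertex set, so the induction also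
    carries that \<open>y\<close> labels a vertex.\<close>
  have "y \<in> set ls \<and> (\<forall>w < num_vertices D. ls ! w = y \<longrightarrow> (u, w) \<in> rtrancl_on ?V ?A)"
    if "(\<lambda>u v. adjacent E (Some u) (Some v))\<^sup>*\<^sup>* (ls ! u) y" for y
    using that
  proof (induction rule: rtranclp_induct)
    case base
    then show ?case using u dist len V by (auto simp: nth_eq_iff_index_eq)
  next
    case (step y z)
    obtain k where k: "k < num_vertices D" "ls ! k = y" using step.IH len by (metis in_set_conv_nth)
    show ?case
    proof (intro conjI allI impI)
      show "z \<in> set ls" using adjacent_labels step.hyps by blast
      fix w assume w: "w < num_vertices D" "ls ! w = z"
      then have "(k, w) \<in> ?A" using k step.hyps arcs_ends_iff by blast
      then show "(u, w) \<in> rtrancl_on ?V ?A"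
        using step.IH k w V by (metis lessThan_iff rtrancl_on_into_rtrancl_on)
    qed
  qed
  then show "joined_by_path D u v" if "joined E (ls ! u) (ls ! v)"
    using that v unfolding joined_by_path_def joined_def reachable_def by blast
qed

lemma boundary_connected_iff: "boundary_connected D \<longleftrightarrow> anchored (set ls) E"
proof -
  have idx: "(\<forall>x\<in>set ls. R x) \<longleftrightarrow> (\<forall>u < num_vertices D. R (ls ! u))"
    "(\<exists>x\<in>set ls. R x) \<longleftrightarrow> (\<exists>u < num_vertices D. R (ls ! u))" for R
    using len by (metis in_set_conv_nth)+
  have "connected (underlying_graph D) \<longleftrightarrow> num_vertices D \<noteq> 0 \<and>
      (\<forall>u < num_vertices D. \<forall>v < num_vertices D. joined_by_path D u v)"
    unfolding connected_def strongly_connected_def joined_by_path_def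
    by (auto simp: underlying_graph_def)
  also have "\<dots> \<longleftrightarrow> set ls \<noteq> {} \<and> (\<forall>x\<in>set ls. \<forall>y\<in>set ls. joined E x y)"
    unfolding idx set_empty length_0_conv[symmetric] len by (simp add: joined_by_path_iff)
  finally have 1: "connected (underlying_graph D) \<longleftrightarrow>
      set ls \<noteq> {} \<and> (\<forall>x\<in>set ls. \<forall>y\<in>set ls. joined E x y)" .
  have "(\<exists>v. boundary_vertex D v \<and> joined_by_path D u v) \<longleftrightarrow>
      (\<exists>y\<in>set ls. adjacent E None (Some y) \<and> joined E (ls ! u) y)" if u: "u < num_vertices D" for u
  proof -
    have "(\<exists>v. boundary_vertex D v \<and> joined_by_path D u v) \<longleftrightarrow>
      (\<exists>v < num_vertices D. boundary_vertex D v \<and> joined_by_path D u v)"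
      unfolding boundary_vertex_def by blast
    also have "\<dots> \<longleftrightarrow> (\<exists>v < num_vertices D. adjacent E None (Some (ls ! v)) \<and> joined E (ls ! u) (ls ! v))"
      by (intro ex_cong1 conj_cong refl) (simp_all add: boundary_vertex_iff joined_by_path_iff[OF u])
    finally show ?thesis unfolding idx .
  qed
  then show ?thesis
    unfolding boundary_connected_def anchored_def 1 idx(1) by simp
qed

end

section \<open>Confluence and normal forms\<close>

lemma valid_iff_fits: "valid D \<longleftrightarrow> fits (source D) (vertices D)"
proof -
  have "valid (Diagram s vs) \<longleftrightarrow> fits s vs" for s vs
  proof (induction vs arbitrary: s)
    case Nil
    then show ?case by (simp add: valid_def num_vertices_def)
  next
    case (Cons v vs)
    \<comment> \<open>Widths below the first vertex are those of the tail started with the remaining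
      width; \<open>inputs v \<le> s\<close> makes that width exact.\<close>
    have W: "W (Diagram s (v # vs)) (Suc n) = W (Diagram (s - inputs v + outputs v) vs) n"
      if "inputs v \<le> s" for n
      using that
      by (induction n) (simp_all add: Delta_def O_of_def I_of_def)
    have "valid (Diagram s (v # vs)) \<longleftrightarrow> offset v + inputs v \<le> s \<and>
        (\<forall>n < length vs. W (Diagram s (v # vs)) (Suc n) \<ge> int (offset (vs ! n)) + int (inputs (vs ! n)))"
      by (auto simp: valid_def num_vertices_def H_of_def I_of_def All_less_Suc2 simp del: W.simps(2))
    also have "\<dots> \<longleftrightarrow> offset v + inputs v \<le> s \<and> valid (Diagram (s - inputs v + outputs v) vs)"
      using W by (auto simp: valid_def num_vertices_def H_of_def I_of_def simp del: W.simps(2))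
    finally show ?case using Cons by simp
  qed
  from this[of "source D" "vertices D"] show ?thesis by simp
qed

lemma split_consecutive:
  assumes "Suc n < length xs"
  obtains us vs where "xs = us @ xs ! n # xs ! Suc n # vs"
    and "\<And>c d. xs[n := c, Suc n := d] = us @ c # d # vs"
proof -
  have split: "xs = take n xs @ xs ! n # xs ! Suc n # drop (Suc (Suc n)) xs"
    using assms by (metis Cons_nth_drop_Suc Suc_lessD id_take_nth_drop)
  have "(us @ a # b # vs)[length us := c, Suc (length us) := d] = us @ c # d # vs"
    for us vs and a b c d :: 'a by (simp add: list_update_append)
  from this[of "take n xs" "xs ! n" "xs ! Suc n" "drop (Suc (Suc n)) xs"] split assms
  have "xs[n := c, Suc n := d] = take n xs @ c # d # drop (Suc (Suc n)) xs" for c d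
    by (metis Suc_lessD length_take less_imp_le_nat min.absorb2)
  with split that show thesis by blast
qed

text \<open>Contexts \<open>us\<close> and \<open>vs\<close> replace index updates, so that overlaps
  can be compared by list equations.\<close>

lemma right_exchange_iff: "right_exchange D D' \<longleftrightarrow> source D' = source D \<and>
  (\<exists>us a b vs. offset a + outputs a \<le> offset b \<and> vertices D = us @ a # b # vs \<and>
     vertices D' = us @ swap_up a b # a # vs)" (is "?L \<longleftrightarrow> ?R")
proof
  assume ?L
  then obtain n where n: "Suc n < length (vertices D)" "H_of D n + O_of D n \<le> H_of D (Suc n)"
    and D': "D' = right_exchange_at D n"
    unfolding right_exchange_def right_admissible_def num_vertices_def by blast
  let ?a = "vertices D ! n" and ?b = "vertices D ! Suc n"
  obtain us vs where split: "vertices D = us @ ?a # ?b # vs"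
    and upd: "\<And>c d. (vertices D)[n := c, Suc n := d] = us @ c # d # vs"
    by (rule split_consecutive[OF n(1)]) blast
  have le: "offset ?a + outputs ?a \<le> offset ?b" using n(2) by (simp add: H_of_def O_of_def)
  have up: "Vertex (nat (int (H_of D (Suc n)) - Delta D n)) (I_of D (Suc n)) (O_of D (Suc n)) = swap_up ?a ?b"
    using le by (simp add: swap_up_def H_of_def I_of_def O_of_def Delta_def)
  have "vertices D' = us @ swap_up ?a ?b # ?a # vs"
    unfolding D' right_exchange_at_def up diagram.sel upd by (simp add: H_of_def I_of_def O_of_def)
  with le split show ?R unfolding D' right_exchange_at_def diagram.sel by blast
next
  assume ?R
  then obtain us a b vs where le: "offset a + outputs a \<le> offset b"
    and D: "vertices D = us @ a # b # vs" and D': "vertices D' = us @ swap_up a b # a # vs"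
    and s: "source D' = source D" by blast
  have nth: "vertices D ! length us = a" "vertices D ! Suc (length us) = b"
    by (simp_all add: D nth_append)
  have "right_admissible D (length us)"
    unfolding right_admissible_def num_vertices_def H_of_def O_of_def nth using le by (simp add: D)
  moreover have "nat (int (offset b) - (int (outputs a) - int (inputs a))) = offset b - outputs a + inputs a"
    using le by simp
  then have "D' = right_exchange_at D (length us)"
    unfolding right_exchange_at_def H_of_def O_of_def I_of_def Delta_def nth
    by (simp add: diagram.expand s D D' list_update_append swap_up_def)
  ultimately show ?L unfolding right_exchange_def by blast
qed

text \<open>The vertex \<open>a\<close> lowered below \<open>b\<close>, with offset H(n) +
  \<Delta>(n+1); it is inverse to \<open>swap_up\<close> on admissible pairs.\<close>

definition swap_down :: "vertex \<Rightarrow> vertex \<Rightarrow> vertex" where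
  "swap_down a b = Vertex (offset a - inputs b + outputs b) (inputs a) (outputs a)"

lemma left_exchange_iff: "left_exchange D D' \<longleftrightarrow> source D' = source D \<and>
  (\<exists>us a b vs. offset b + inputs b \<le> offset a \<and> vertices D = us @ a # b # vs \<and>
     vertices D' = us @ b # swap_down a b # vs)" (is "?L \<longleftrightarrow> ?R")
proof
  assume ?L
  then obtain n where n: "Suc n < length (vertices D)" "H_of D (Suc n) + I_of D (Suc n) \<le> H_of D n"
    and D': "D' = left_exchange_at D n"
    unfolding left_exchange_def left_admissible_def num_vertices_def by blast
  let ?a = "vertices D ! n" and ?b = "vertices D ! Suc n"
  obtain us vs where split: "vertices D = us @ ?a # ?b # vs"
    and upd: "\<And>c d. (vertices D)[n := c, Suc n := d] = us @ c # d # vs"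
    by (rule split_consecutive[OF n(1)]) blast
  have le: "offset ?b + inputs ?b \<le> offset ?a" using n(2) by (simp add: H_of_def I_of_def)
  have down: "Vertex (nat (int (H_of D n) + Delta D (Suc n))) (I_of D n) (O_of D n) = swap_down ?a ?b"
    using le by (simp add: swap_down_def H_of_def I_of_def O_of_def Delta_def)
  have "vertices D' = us @ ?b # swap_down ?a ?b # vs"
    unfolding D' left_exchange_at_def down diagram.sel upd by (simp add: H_of_def I_of_def O_of_def)
  with le split show ?R unfolding D' left_exchange_at_def diagram.sel by blast
next
  assume ?R
  then obtain us a b vs where le: "offset b + inputs b \<le> offset a"
    and D: "vertices D = us @ a # b # vs" and D': "vertices D' = us @ b # swap_down a b # vs"
    and s: "source D' = source D" by blast
  have nth: "vertices D ! length us = a" "vertices D ! Suc (length us) = b"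
    by (simp_all add: D nth_append)
  have "left_admissible D (length us)"
    unfolding left_admissible_def num_vertices_def H_of_def I_of_def nth using le by (simp add: D)
  moreover have "nat (int (offset a) + (int (outputs b) - int (inputs b))) = offset a - inputs b + outputs b"
    using le by simp
  then have "D' = left_exchange_at D (length us)"
    unfolding left_exchange_at_def H_of_def O_of_def I_of_def Delta_def nth
    by (simp add: diagram.expand s D D' list_update_append swap_down_def)
  ultimately show ?L unfolding left_exchange_def by blast
qed

text \<open>Each exchange makes the opposite one admissible at the same place, and the two offset
  shifts cancel.\<close>

lemma left_exchange_iff_right_exchange: "left_exchange D D' \<longleftrightarrow> right_exchange D' D"
proof -
  have *: "swap_up b (swap_down a b) = a" "offset b + outputs b \<le> offset (swap_down a b)"
    if "offset b + inputs b \<le> offset a" for a b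
    using that by (simp_all add: swap_up_def swap_down_def)
  have **: "swap_down (swap_up a b) a = b" "offset a + inputs a \<le> offset (swap_up a b)"
    if "offset a + outputs a \<le> offset b" for a b
    using that by (simp_all add: swap_up_def swap_down_def)
  show ?thesis
    unfolding left_exchange_iff right_exchange_iff by (metis * **)
qed

lemma right_exchangeI: "offset a + outputs a \<le> offset b \<Longrightarrow>
    right_exchange (Diagram s (us @ a # b # vs)) (Diagram s (us @ swap_up a b # a # vs))"
  unfolding right_exchange_iff diagram.sel by blast

section \<open>Local confluence and Newman's lemma\<close>

text \<open>The second pair starts no higher than the first, so the two coincide, share one vertex,
  or are disjoint. Only a shared vertex gives a genuine critical pair.\<close>

lemma right_exchange_peak:
  assumes le: "offset a + outputs a \<le> offset b" "offset a' + outputs a' \<le> offset b'"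
    and eq: "us @ a # b # vs = us @ zs @ a' # b' # vs'"
  shows "\<exists>D. right_exchange\<^sup>*\<^sup>* (Diagram s (us @ swap_up a b # a # vs)) D \<and>
    right_exchange\<^sup>*\<^sup>* (Diagram s (us @ zs @ swap_up a' b' # a' # vs')) D"
proof -
  let ?D = "Diagram s"
  consider "zs = []" "a' = a" "b' = b" "vs' = vs" | "zs = [a]" "a' = b" "vs = b' # vs'"
    | ws where "zs = a # b # ws" "vs = ws @ a' # b' # vs'"
    using eq by (cases zs; cases "tl zs") auto
  then show ?thesis
  proof cases
    case 1
    then show ?thesis by auto
  next
    case 2
    \<comment> \<open>Both routes reverse the three vertices \<open>a\<close>, \<open>b\<close>,
      \<open>b'\<close>. \<open>?c\<close> is \<open>b'\<close> lifted over both others; the next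
      equation says that the order of lifting is immaterial.\<close>
    let ?c = "swap_up a (swap_up b b')"
    have c: "swap_up (swap_up a b) (swap_up a b') = ?c"
      using le 2 by (simp add: swap_up_def)
    \<comment> \<open>Lying to the right is transitive, so \<open>b'\<close> can also pass
      \<open>a\<close>.\<close>
    have "offset a + outputs a \<le> offset b'" using le 2 by simp
    from right_exchangeI[OF this, of s "us @ [swap_up a b]" vs']
    have "right_exchange (?D (us @ swap_up a b # a # vs)) (?D (us @ swap_up a b # swap_up a b' # a # vs'))"
      using 2 by simp
    moreover have "offset (swap_up a b) + outputs (swap_up a b) \<le> offset (swap_up a b')"
      using le 2 by (simp add: swap_up_def)
    from right_exchangeI[OF this, of s us "a # vs'"]
    have "right_exchange (?D (us @ swap_up a b # swap_up a b' # a # vs'))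
        (?D (us @ ?c # swap_up a b # a # vs'))"
      unfolding c .
    moreover have "offset a + outputs a \<le> offset (swap_up b b')"
      using le 2 by (simp add: swap_up_def)
    from right_exchangeI[OF this, of s us "b # vs'"]
    have "right_exchange (?D (us @ zs @ swap_up a' b' # a' # vs')) (?D (us @ ?c # a # b # vs'))"
      using 2 by simp
    moreover from right_exchangeI[OF le(1), of s "us @ [?c]" vs']
    have "right_exchange (?D (us @ ?c # a # b # vs')) (?D (us @ ?c # swap_up a b # a # vs'))"
      by simp
    ultimately show ?thesis by (meson converse_rtranclp_into_rtranclp r_into_rtranclp)
  next
    case 3
    let ?E = "?D (us @ swap_up a b # a # ws @ swap_up a' b' # a' # vs')"
    from right_exchangeI[OF le(2), of s "us @ swap_up a b # a # ws" vs']
    have "right_exchange (?D (us @ swap_up a b # a # vs)) ?E" using 3 by simp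
    moreover from right_exchangeI[OF le(1), of s us "ws @ swap_up a' b' # a' # vs'"]
    have "right_exchange (?D (us @ zs @ swap_up a' b' # a' # vs')) ?E" using 3 by simp
    ultimately show ?thesis by blast
  qed
qed

lemma right_exchange_local_confluence:
  assumes "right_exchange D D1" "right_exchange D D2"
  shows "\<exists>D3. right_exchange\<^sup>*\<^sup>* D1 D3 \<and> right_exchange\<^sup>*\<^sup>* D2 D3"
proof -
  obtain us a b vs where 1: "offset a + outputs a \<le> offset b" "vertices D = us @ a # b # vs"
    "vertices D1 = us @ swap_up a b # a # vs" "source D1 = source D"
    using assms(1) unfolding right_exchange_iff by blast
  obtain us' a' b' vs' where 2: "offset a' + outputs a' \<le> offset b'" "vertices D = us' @ a' # b' # vs'"
    "vertices D2 = us' @ swap_up a' b' # a' # vs'" "source D2 = source D"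
    using assms(2) unfolding right_exchange_iff by blast
  have D1: "D1 = Diagram (source D) (us @ swap_up a b # a # vs)"
    and D2: "D2 = Diagram (source D) (us' @ swap_up a' b' # a' # vs')"
    using 1 2 by (metis diagram.collapse)+
  have eq: "us @ a # b # vs = us' @ a' # b' # vs'" using 1 2 by simp
  then consider zs where "us' = us @ zs" | zs where "us = us' @ zs"
    unfolding append_eq_append_conv2 by blast
  then show ?thesis
  proof cases
    case (1 zs)
    have "us @ a # b # vs = us @ zs @ a' # b' # vs'" using eq 1 by simp
    from right_exchange_peak[OF \<open>offset a + outputs a \<le> offset b\<close> \<open>offset a' + outputs a' \<le> offset b'\<close> this]
    show ?thesis unfolding D1 D2 1 append_assoc .
  next
    case (2 zs)
    have "us' @ a' # b' # vs' = us' @ zs @ a # b # vs" using eq 2 by simp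
    from right_exchange_peak[OF \<open>offset a' + outputs a' \<le> offset b'\<close> \<open>offset a + outputs a \<le> offset b\<close> this, of "source D"]
    show ?thesis unfolding D1 D2 2 append_assoc by blast
  qed
qed

text \<open>Termination is assumed at one element only, since \<open>right_exchange\<close> does not
  terminate everywhere: two vertices without inputs and outputs at offset 0 can be exchanged
  forever.\<close>

lemma newman_termip:
  assumes "termip r x"
    and local: "\<And>x y z. r x y \<Longrightarrow> r x z \<Longrightarrow> \<exists>u. r\<^sup>*\<^sup>* y u \<and> r\<^sup>*\<^sup>* z u"
    and "r\<^sup>*\<^sup>* x y" "r\<^sup>*\<^sup>* x z"
  shows "\<exists>u. r\<^sup>*\<^sup>* y u \<and> r\<^sup>*\<^sup>* z u"
  using assms(1,3,4)
proof (induction arbitrary: y z rule: accp.induct)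
  case (accI x)
  show ?case
  proof (cases "x = y \<or> x = z")
    case True
    then show ?thesis using accI.prems by blast
  next
    case False
    then obtain y' z' where y': "r x y'" "r\<^sup>*\<^sup>* y' y" and z': "r x z'" "r\<^sup>*\<^sup>* z' z"
      using accI.prems by (metis converse_rtranclpE)
    obtain w where w: "r\<^sup>*\<^sup>* y' w" "r\<^sup>*\<^sup>* z' w" using local y'(1) z'(1) by blast
    obtain t where t: "r\<^sup>*\<^sup>* y t" "r\<^sup>*\<^sup>* w t" using accI.IH[of y' y w] y' w by blast
    obtain s where "r\<^sup>*\<^sup>* z s" "r\<^sup>*\<^sup>* t s"
      using accI.IH[of z' z t] z' rtranclp_trans[OF w(2) t(2)] by blast
    then show ?thesis using rtranclp_trans[OF t(1)] by blast
  qed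
qed

section \<open>Invariance and termination\<close>

text \<open>Any labelling of \<open>D\<close> can be carried along an exchange.\<close>

lemma right_exchange_passes:
  assumes "right_exchange D D'" "map snd ps = vertices D"
  obtains x y ps' where "passes x y ps ps'" "map snd ps' = vertices D'"
proof -
  obtain us a b vs where *: "offset a + outputs a \<le> offset b" "vertices D = us @ a # b # vs"
    "vertices D' = us @ swap_up a b # a # vs"
    using assms(1) unfolding right_exchange_iff by blast
  then obtain us' x y vs' where "ps = us' @ (x, a) # (y, b) # vs'" "map snd us' = us" "map snd vs' = vs"
    using assms(2) by (auto simp: map_eq_append_conv map_eq_Cons_conv)
  then show thesis
    using * that[of x y "us' @ (y, swap_up a b) # (x, a) # vs'"] unfolding passes_def by auto
qed

lemma right_exchange_valid_iff: "right_exchange D D' \<Longrightarrow> valid D' \<longleftrightarrow> valid D"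
  unfolding right_exchange_iff valid_iff_fits by (auto simp: fits_exchange)

lemma fresh_top_wires: "fresh V (top_wires D)"
  by (auto simp: fresh_def top_wires_def distinct_map inj_on_def)

lemma labelled_diagram_zip:
  assumes "valid D" "distinct (map fst ps)" "map snd ps = vertices D"
  shows "labelled_diagram D (map fst ps)" "zip (map fst ps) (vertices D) = ps"
proof -
  show "labelled_diagram D (map fst ps)"
    using assms length_map[of snd ps] by unfold_locales (auto simp: num_vertices_def)
  show "zip (map fst ps) (vertices D) = ps" using assms(3) zip_map_fst_snd by metis
qed

lemma boundary_connected_iff_anchored:
  assumes "valid D" "distinct (map fst ps)" "map snd ps = vertices D"
  shows "boundary_connected D \<longleftrightarrow> anchored (fst ` set ps) (ends (top_wires D) ps)"
  using labelled_diagram.boundary_connected_iff[OF labelled_diagram_zip(1)[OF assms]]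
  unfolding labelled_diagram_zip(2)[OF assms] by simp

text \<open>With labels carried along, both diagrams have the same label set and the same
  \<open>ends\<close>, which determine boundary connectedness.\<close>

lemma right_exchange_boundary_connected_iff:
  assumes r: "right_exchange D D'" and val: "valid D"
  shows "boundary_connected D' \<longleftrightarrow> boundary_connected D"
proof -
  define ps where "ps = zip [0..<length (vertices D)] (vertices D)"
  have ps: "distinct (map fst ps)" "map snd ps = vertices D" by (simp_all add: ps_def)
  obtain x y ps' where pass: "passes x y ps ps'" and ps': "map snd ps' = vertices D'"
    using right_exchange_passes[OF r ps(2)] .
  have "source D' = source D" using r by (simp add: right_exchange_iff)
  then have top: "top_wires D' = (top_wires D :: nat port list)" by (simp add: top_wires_def)
  have "fits (length (top_wires D :: nat port list)) (map snd ps)"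
    using val ps(2) by (simp add: valid_iff_fits top_wires_def)
  from passes_ends[OF pass this fresh_top_wires ps(1)]
  have "ends (top_wires D) ps' = ends (top_wires D) ps" .
  moreover have "valid D'" "distinct (map fst ps')"
    using right_exchange_valid_iff[OF r] val passes_labels(2)[OF pass] ps by simp_all
  ultimately show ?thesis
    using boundary_connected_iff_anchored[OF val ps]
      boundary_connected_iff_anchored[OF _ _ ps'] passes_labels(1)[OF pass] top by simp
qed

lemma right_exchange_terminates:
  assumes "valid D" "boundary_connected D"
  shows "termip right_exchange D"
proof -
  \<comment> \<open>Vertices are labelled once, by their initial heights; the labels then follow
    them through the reduction.\<close>
  define ps where "ps = zip [0..<length (vertices D)] (vertices D)"
  have ps: "distinct (map fst ps)" "map snd ps = vertices D" by (simp_all add: ps_def)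
  define ws where "ws = (top_wires D :: nat port list)"
  let ?C = "configs ws (fst ` set ps) (ends ws ps)"
  have "anchored (fst ` set ps) (ends ws ps)"
    using boundary_connected_iff_anchored[OF assms(1) ps] assms(2) by (simp add: ws_def)
  then obtain \<Phi> :: "(nat \<times> vertex) list \<Rightarrow> nat" where
    \<Phi>: "\<And>ps ps' x y. ps \<in> ?C \<Longrightarrow> passes x y ps ps' \<Longrightarrow> \<Phi> ps' < \<Phi> ps"
    using configs_potential[of "fst ` set ps" "ends ws ps" ws] by auto
  have "termip right_exchange D'"
    if "qs \<in> ?C" "map snd qs = vertices D'" for qs D'
    using that
  proof (induction "\<Phi> qs" arbitrary: qs D' rule: less_induct)
    case less
    show ?case
    proof (rule accp.accI)
      fix D'' assume "right_exchange\<inverse>\<inverse> D'' D'"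
      then obtain x y qs' where *: "passes x y qs qs'" "map snd qs' = vertices D''"
        using right_exchange_passes[OF _ less.prems(2)] by (metis conversepE)
      show "termip right_exchange D''"
        using less.hyps[OF \<Phi>[OF less.prems(1) *(1)] passes_configs[OF *(1) less.prems(1)] *(2)] .
    qed
  qed
  moreover have "ps \<in> ?C"
    using assms(1) ps fresh_top_wires by (simp add: configs_def ws_def valid_iff_fits top_wires_def)
  ultimately show ?thesis using ps(2) by blast
qed

lemma termip_no_infinite_chain:
  assumes "termip r x"
  shows "\<not> (\<exists>f :: nat \<Rightarrow> 'a. f 0 = x \<and> (\<forall>i. r (f i) (f (Suc i))))"
  using assms
proof (induction rule: accp.induct)
  case (accI x)
  show ?case
  proof
    assume "\<exists>f :: nat \<Rightarrow> 'a. f 0 = x \<and> (\<forall>i. r (f i) (f (Suc i)))"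
    then obtain f :: "nat \<Rightarrow> 'a" where "f 0 = x" "\<forall>i. r (f i) (f (Suc i))" by blast
    then show False using accI.IH[of "f 1"] by (auto dest!: spec[of _ "\<lambda>i. f (Suc i)"])
  qed
qed

lemma termip_normal_form:
  assumes "termip r x"
  shows "\<exists>y. r\<^sup>*\<^sup>* x y \<and> \<not> (\<exists>z. r y z)"
  using assms
proof (induction rule: accp.induct)
  case (accI x)
  show ?case
  proof (cases "\<exists>y. r x y")
    case True
    then show ?thesis using accI.IH by (metis conversep_iff converse_rtranclp_into_rtranclp)
  qed blast
qed

theorem theorem39:
  shows "confluentp (\<lambda>D D'. valid D \<and> boundary_connected D \<and>
           valid D' \<and> boundary_connected D' \<and> right_exchange D D')
    \<and> (\<forall>D. valid D \<and> boundary_connected D \<longrightarrow>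
         (\<exists>!E. right_normal_form_of D E)
         \<and> \<not> (\<exists>f :: nat \<Rightarrow> diagram. f 0 = D \<and> (\<forall>i. right_exchange (f i) (f (Suc i))))
         \<and> (\<forall>F. right_exchange\<^sup>*\<^sup>* D F \<and> \<not> (\<exists>G. right_exchange F G) \<longrightarrow>
              F = the_right_normal_form D))
    \<and> (\<forall>D D'. valid D \<and> boundary_connected D \<and> valid D' \<and> boundary_connected D' \<longrightarrow>
         (equivalent D D' \<longleftrightarrow> the_right_normal_form D = the_right_normal_form D'))"
proof -
  define good where "good D \<longleftrightarrow> valid D \<and> boundary_connected D" for D
  define R where "R D D' \<longleftrightarrow> valid D \<and> boundary_connected D \<and>
    valid D' \<and> boundary_connected D' \<and> right_exchange D D'" for D D'
  \<comment> \<open>The equivalence is used backwards for left exchanges, which are reversed right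
    exchanges.\<close>
  have good_step: "good D' \<longleftrightarrow> good D" if "right_exchange D D'" for D D'
    using right_exchange_valid_iff[OF that] right_exchange_boundary_connected_iff[OF that]
    unfolding good_def by blast
  have good_steps: "good D' \<and> R\<^sup>*\<^sup>* D D'" if "right_exchange\<^sup>*\<^sup>* D D'" "good D" for D D'
    using that
  proof (induction rule: rtranclp_induct)
    case (step y z)
    then have "R y z" using good_step unfolding R_def good_def by blast
    then show ?case using step good_step by (meson rtranclp.rtrancl_into_rtrancl)
  qed simp
  have R_steps: "right_exchange\<^sup>*\<^sup>* D D'" if "R\<^sup>*\<^sup>* D D'" for D D'
    using that by (rule mono_rtranclp[rule_format, rotated]) (simp add: R_def)
  have acc: "termip right_exchange D" if "good D" for D
    using that right_exchange_terminates unfolding good_def by blast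
  have join: "\<exists>F. right_exchange\<^sup>*\<^sup>* D1 F \<and> right_exchange\<^sup>*\<^sup>* D2 F"
    if "good D" "right_exchange\<^sup>*\<^sup>* D D1" "right_exchange\<^sup>*\<^sup>* D D2" for D D1 D2
    using newman_termip[OF acc[OF that(1)] right_exchange_local_confluence that(2,3)] .
  have nf_eq: "F = F'"
    if "good D" "right_exchange\<^sup>*\<^sup>* D F" "right_exchange\<^sup>*\<^sup>* D F'"
      "\<not> (\<exists>G. right_exchange F G)" "\<not> (\<exists>G. right_exchange F' G)" for D F F'
    using join[OF that(1-3)] that(4,5) by (metis converse_rtranclpE)
  \<comment> \<open>The validity demanded by \<open>right_normal_form\<close> comes from
    \<open>good_steps\<close>.\<close>
  have nf_of_iff: "right_normal_form_of D F \<longleftrightarrow> right_exchange\<^sup>*\<^sup>* D F \<and> \<not> (\<exists>G. right_exchange F G)"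
    if "good D" for D F
    using good_steps[OF _ that] unfolding right_normal_form_of_def right_normal_form_def good_def by blast
  have ex1: "\<exists>!F. right_normal_form_of D F" if "good D" for D
    using termip_normal_form[OF acc[OF that]] nf_eq[OF that] unfolding nf_of_iff[OF that] by blast
  have the_nf: "right_normal_form_of D (the_right_normal_form D)" if "good D" for D
    unfolding the_right_normal_form_def by (rule theI'[OF ex1[OF that]])
  have the_nf_eq: "F = the_right_normal_form D" if "good D" "right_normal_form_of D F" for D F
    using ex1[OF that(1)] the_nf[OF that(1)] that(2) by blast
  have nf_step: "the_right_normal_form D' = the_right_normal_form D"
    if "right_exchange D D'" "good D" for D D'
  proof (rule the_nf_eq[OF that(2)])
    have "good D'" using good_step that by blast
    then show "right_normal_form_of D (the_right_normal_form D')"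
      using the_nf that unfolding right_normal_form_of_def
      by (meson converse_rtranclp_into_rtranclp)
  qed
  have equiv: "good D' \<and> the_right_normal_form D' = the_right_normal_form D"
    if "equivalent D D'" "good D" for D D'
    using that unfolding equivalent_def
  proof (induction rule: rtranclp_induct)
    case (step y z)
    then show ?case using good_step nf_step unfolding left_exchange_iff_right_exchange by metis
  qed simp
  have down: "equivalent D F" if "right_exchange\<^sup>*\<^sup>* D F" for D F
    using that unfolding equivalent_def by (rule mono_rtranclp[rule_format, rotated]) simp
  have up: "equivalent F D" if "right_exchange\<^sup>*\<^sup>* D F" for D F
  proof -
    have "(right_exchange\<inverse>\<inverse>)\<^sup>*\<^sup>* F D" using that by (simp add: rtranclp_conversep)
    then show ?thesis unfolding equivalent_def
      by (rule mono_rtranclp[rule_format, rotated]) (simp add: left_exchange_iff_right_exchange)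
  qed
  have "confluentp R"
  proof (rule confluentpI)
    fix x y z assume "R\<^sup>*\<^sup>* x y" "R\<^sup>*\<^sup>* x z"
    show "\<exists>u. R\<^sup>*\<^sup>* y u \<and> R\<^sup>*\<^sup>* z u"
    proof (cases "good x")
      case True
      then obtain u where u: "right_exchange\<^sup>*\<^sup>* y u" "right_exchange\<^sup>*\<^sup>* z u"
        using join R_steps \<open>R\<^sup>*\<^sup>* x y\<close> \<open>R\<^sup>*\<^sup>* x z\<close> by blast
      have "good y" "good z" using good_steps True R_steps \<open>R\<^sup>*\<^sup>* x y\<close> \<open>R\<^sup>*\<^sup>* x z\<close> by blast+
      then show ?thesis using good_steps u by blast
    next
      case False
      \<comment> \<open>From a diagram that is not \<open>good\<close>, \<open>R\<close> has no
        step, so both paths are trivial.\<close>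
      then have "\<not> R x w" for w by (auto simp: R_def good_def)
      then have "y = x" "z = x"
        using \<open>R\<^sup>*\<^sup>* x y\<close> \<open>R\<^sup>*\<^sup>* x z\<close> by (metis converse_rtranclpE)+
      then show ?thesis by blast
    qed
  qed
  moreover have "equivalent D D' \<longleftrightarrow> the_right_normal_form D = the_right_normal_form D'"
    if "good D" "good D'" for D D'
  proof
    assume "equivalent D D'"
    then show "the_right_normal_form D = the_right_normal_form D'" using equiv that by metis
  next
    assume eq: "the_right_normal_form D = the_right_normal_form D'"
    \<comment> \<open>Reduce \<open>D\<close> to the common normal form, then undo the reduction of
      \<open>D'\<close> by left exchanges.\<close>
    have "equivalent D (the_right_normal_form D)" "equivalent (the_right_normal_form D) D'"
      using the_nf[OF that(1)] the_nf[OF that(2)] eq down up unfolding right_normal_form_of_def by metis+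
    then show "equivalent D D'" unfolding equivalent_def by (rule rtranclp_trans)
  qed
  moreover have "F = the_right_normal_form D"
    if "good D" "right_exchange\<^sup>*\<^sup>* D F \<and> \<not> (\<exists>G. right_exchange F G)" for D F
    using the_nf_eq nf_of_iff that by blast
  ultimately show ?thesis
    using ex1 termip_no_infinite_chain[OF acc] unfolding R_def good_def by blast
qed

end
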